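(* Let $f:\mathbb{R}\to\mathbb{R}$ be locally Lipschitz continuous and let $x^*$ be a solution to $f(x)=0$. Let $\{x^k\}$ be the sequence generated by the secant method (described in the context) for solving $f(x)=0$. For $k\ge-1$, denote $e_k:=x^k-x^*$ and assume that $|e_k|>0$. For $k\ge1$, denote $c_k:=|e_k|/(|e_{k-1}||e_{k-2}|)$. Assume that the Clarke generalized Jacobian $\partial f(x^* )$ is a singleton and nondegenerate (i.e. its only element is nonzero). It holds that: (i) if $f$ is semismooth at $x^*$, the sequence $\{x^k\}$ converges to $x^*$ Q-superlinearly; (ii) if $f$ is strongly semismooth at $x^*$, then either one of the following two properties is satisfied: (1) $\{x^k\}$ converges to $x^*$ superlinearly with Q-order at least $(1+\sqrt5)/2$; (2) $\{x^k\}$ converges to $x^*$ superlinearly with R-order at least $(1+\sqrt5)/2$ and for any constant $\underline{C}>0$, there exists a subsequence $\{c_{i_k}\}$ satisfying $c_{i_k}<\underline{C}\,i_k^{-i_k}$.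
   Context: Secant method: the input is two generic starting points $x^{-1},x^0\in\mathbb{R}$; set $k=0$; while $f(x^k)\ne0$, compute $$x^{k+1}=x^k-\big(\delta_f(x^k,x^{k-1})\big)^{-1}f(x^k),\qquad \delta_f(x,y):=\frac{f(x)-f(y)}{x-y}\ (x\ne y),$$ and set $k=k+1$. The Clarke generalized Jacobian $\partial f(x)$ is the convex hull of all limits of $f'(x_j)$ along sequences $x_j\to x$ of points where $f$ is differentiable. A locally Lipschitz $f$ is semismooth at $x$ if it is directionally differentiable at $x$ and $f(x+\Delta x)-f(x)-V\Delta x=o(|\Delta x|)$ for any $V\in\partial f(x+\Delta x)$ with $\Delta x\to0$; it is strongly semismooth at $x$ if moreover the right-hand side is $O(|\Delta x|^2)$. Q-superlinear convergence: $|e_{k+1}|=o(|e_k|)$. Q-order at least $\tau>1$: $\lim_{k\to\infty}|e_{k+1}|/|e_k|^q=0$ for every $q\in[1,\tau)$. R-order at least $\tau>1$: $\lim_{k\to\infty}|e_k|^{1/q^k}=0$ for every $q\in(1,\tau)$ (the usual Ortega–Rheinboldt notions of order).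
   Formalization: The claim is false for arbitrary starting points (f(x)=x·exp(-x²), x*=0, starting at 2 and 3), so the sequence is also assumed to have some two consecutive iterates within a radius r>0 of x*, where r depends only on f and x*; every sequence converging to x* satisfies this. *)

theory Defs
  imports "HOL-Analysis.Analysis" "HOL-Library.Landau_Symbols"
begin

definition locally_lipschitz :: "(real \<Rightarrow> real) \<Rightarrow> bool" where
  "locally_lipschitz f \<longleftrightarrow> (\<forall>x. \<exists>u>0. \<exists>L. L-lipschitz_on (cball x u) f)"

definition clarke_jacobian :: "(real \<Rightarrow> real) \<Rightarrow> real \<Rightarrow> real set" where
  "clarke_jacobian f x = convex hull
     {v. \<exists>X :: nat \<Rightarrow> real. (\<forall>j. f differentiable (at (X j))) \<and> X \<longlonglongrightarrow> x \<and>
           (\<lambda>j. deriv f (X j)) \<longlonglongrightarrow> v}"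

definition directionally_differentiable_at :: "(real \<Rightarrow> real) \<Rightarrow> real \<Rightarrow> bool" where
  "directionally_differentiable_at f x \<longleftrightarrow>
     (\<forall>d. \<exists>l. ((\<lambda>t. (f (x + t * d) - f x) / t) \<longlongrightarrow> l) (at_right 0))"

(* The Landau bounds for f (x + h) - f x - V * h are uniform in V \<in> clarke_jacobian f (x + h). *)

definition semismooth_at :: "(real \<Rightarrow> real) \<Rightarrow> real \<Rightarrow> bool" where
  "semismooth_at f x \<longleftrightarrow>
     locally_lipschitz f \<and> directionally_differentiable_at f x \<and>
     (\<forall>\<epsilon>>0. \<forall>\<^sub>F h in at 0. \<forall>V\<in>clarke_jacobian f (x + h).
        \<bar>f (x + h) - f x - V * h\<bar> \<le> \<epsilon> * \<bar>h\<bar>)"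

definition strongly_semismooth_at :: "(real \<Rightarrow> real) \<Rightarrow> real \<Rightarrow> bool" where
  "strongly_semismooth_at f x \<longleftrightarrow>
     semismooth_at f x \<and>
     (\<exists>M. \<forall>\<^sub>F h in at 0. \<forall>V\<in>clarke_jacobian f (x + h).
        \<bar>f (x + h) - f x - V * h\<bar> \<le> M * \<bar>h\<bar>\<^sup>2)"

definition divided_difference :: "(real \<Rightarrow> real) \<Rightarrow> real \<Rightarrow> real \<Rightarrow> real" where
  "divided_difference f x y = (f x - f y) / (x - y)"

(* An infinite run of the secant method. The indices are those of the iterates, starting at -1;
   values of x below -1 are irrelevant. f (x k) \<noteq> 0 is the loop condition. Distinct starting
   points and nonzero divided differences make every step well defined: inductively
   x k \<noteq> x (k - 1) for all k \<ge> 0, so no step divides by zero. *)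

definition secant_sequence :: "(real \<Rightarrow> real) \<Rightarrow> (int \<Rightarrow> real) \<Rightarrow> bool" where
  "secant_sequence f x \<longleftrightarrow>
     x 0 \<noteq> x (-1) \<and>
     (\<forall>k\<ge>0. f (x k) \<noteq> 0 \<and> divided_difference f (x k) (x (k - 1)) \<noteq> 0 \<and>
        x (k + 1) = x k - inverse (divided_difference f (x k) (x (k - 1))) * f (x k))"

definition error_ratio :: "(int \<Rightarrow> real) \<Rightarrow> int \<Rightarrow> real" where
  "error_ratio e k = \<bar>e k\<bar> / (\<bar>e (k - 1)\<bar> * \<bar>e (k - 2)\<bar>)"

(* Convergence notions for an error sequence e (iterates minus limit). *)

definition q_superlinear :: "(nat \<Rightarrow> real) \<Rightarrow> bool" where
  "q_superlinear e \<longleftrightarrow> e \<longlonglongrightarrow> 0 \<and> (\<lambda>k. \<bar>e (Suc k)\<bar>) \<in> o(\<lambda>k. \<bar>e k\<bar>)"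

definition q_order_at_least :: "(nat \<Rightarrow> real) \<Rightarrow> real \<Rightarrow> bool" where
  "q_order_at_least e \<tau> \<longleftrightarrow>
     (\<forall>q. 1 \<le> q \<and> q < \<tau> \<longrightarrow> (\<lambda>k. \<bar>e (Suc k)\<bar> / \<bar>e k\<bar> powr q) \<longlonglongrightarrow> 0)"

definition r_order_at_least :: "(nat \<Rightarrow> real) \<Rightarrow> real \<Rightarrow> bool" where
  "r_order_at_least e \<tau> \<longleftrightarrow>
     (\<forall>q. 1 < q \<and> q < \<tau> \<longrightarrow> (\<lambda>k. \<bar>e k\<bar> powr (1 / q ^ k)) \<longlonglongrightarrow> 0)"

end

theory Submission
  imports Defs "HOL-Real_Asymp.Real_Asymp"
begin

text \<open>
  Write \<open>z\<close> for the root and \<open>v\<close> for the only element of the Clarke Jacobian at \<open>z\<close>.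

  The Clarke Jacobian knows \<open>f\<close> only through its derivatives at points of differentiability. The
  bridge to chords is a mean value inequality for Lipschitz functions on the line in which the
  derivative is bounded only where it exists (\<open>lipschitz_increment_le\<close>). It rests on Lebesgue's
  theorem that such a function is differentiable almost everywhere. The set where short chords have
  slopes both below \<open>p\<close> and above \<open>q > p\<close> is null: by Vitali's covering theorem, an increment of the
  function over an interval bounds the measure of the part of that set in the interval, and the
  bounds for \<open>f\<close> and \<open>- f\<close> together show that the set misses a fixed fraction of every interval
  (\<open>negligible_straddling_chords\<close>).

  Consequently \<open>v\<close> is a strict derivative of \<open>f\<close> at \<open>z\<close>
  (\<open>clarke_singleton_strict_derivative\<close>), so the divided difference in a secant step and the
  quotient \<open>f x / (x - z)\<close> both tend to \<open>v\<close>. The error is multiplied by their difference, up to a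
  bounded factor, hence convergence is superlinear. Under strong semismoothness both quantities tend
  to \<open>v\<close> at a linear rate (\<open>strongly_semismooth_chord_rate\<close>), which gives
  \<open>\<bar>e (n + 2)\<bar> \<le> C * \<bar>e (n + 1)\<bar> * \<bar>e n\<bar>\<close> eventually.

  For \<open>l n = - ln \<bar>e n\<bar>\<close> this is a Fibonacci inequality, so with \<open>\<phi>\<close> the golden ratio, \<open>l n\<close> grows
  at least like \<open>\<phi> ^ n\<close>, and the R-order is at least \<open>\<phi>\<close>. If for some \<open>B > 0\<close> no subsequence of
  the error ratios lies below \<open>B * n powr (- n)\<close>, then \<open>l (n + 2) = l (n + 1) + l n + O(n\<^sup>2)\<close>, hence
  \<open>l (n + 1) - \<phi> * l n\<close> grows only polynomially. As \<open>l n\<close> grows exponentially,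
  \<open>l (n + 1) - q * l n\<close> tends to infinity for every \<open>q < \<phi>\<close>, which is the Q-order claim.
\<close>

section \<open>Null sets via Vitali coverings\<close>

lemma mono_on_sum_disjoint_intervals_le:
  fixes g :: "real \<Rightarrow> real"
  assumes "finite F" "mono_on {a..b} g" "a \<le> b"
    and "\<And>i. i \<in> F \<Longrightarrow> a \<le> u i \<and> u i \<le> v i \<and> v i \<le> b"
    and "pairwise (\<lambda>i j. disjnt {u i..v i} {u j..v j}) F"
  shows "(\<Sum>i\<in>F. g (v i) - g (u i)) \<le> g b - g a"
  using assms
proof (induction F arbitrary: b rule: finite_ranking_induct[where f = v])
  case empty
  then show ?case by (auto intro: mono_onD)
next
  case (insert x S)
  have x: "a \<le> u x" "u x \<le> v x" "v x \<le> b" using insert.prems(3)[of x] by auto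
  show ?case
  proof (cases "x \<in> S")
    case True
    then show ?thesis using insert.IH insert.prems by (simp add: insert_absorb)
  next
    case False
    have left: "a \<le> u y \<and> u y \<le> v y \<and> v y \<le> u x" if "y \<in> S" for y
    proof -
      have "disjnt {u x..v x} {u y..v y}"
        using insert.prems(4) that False by (auto simp: pairwise_def)
      then have "\<not> (u x \<le> v y \<and> v y \<le> v x \<and> u y \<le> v y)"
        by (auto simp: disjnt_iff)
      then show ?thesis using insert.hyps(2)[OF that] insert.prems(3)[of y] that by auto
    qed
    have "(\<Sum>i\<in>S. g (v i) - g (u i)) \<le> g (u x) - g a"
    proof (rule insert.IH)
      show "mono_on {a..u x} g" by (rule mono_on_subset[OF insert.prems(1)]) (use x in auto)
      show "pairwise (\<lambda>i j. disjnt {u i..v i} {u j..v j}) S"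
        using insert.prems(4) by (auto simp: pairwise_def)
    qed (use left x in auto)
    moreover have "g (v x) \<le> g b"
      by (rule mono_onD[OF insert.prems(1)]) (use x in auto)
    ultimately show ?thesis
      using False insert.hyps by simp
  qed
qed

text \<open>Lebesgue's growth lemma: by Vitali's theorem almost all of \<open>S\<close> is covered by disjoint
  intervals on which \<open>g\<close> grows at rate at least \<open>s\<close>, and a monotone function cannot grow more on
  disjoint subintervals than on the whole interval.\<close>

lemma mono_on_steep_set_outer_measure_le:
  fixes g :: "real \<Rightarrow> real"
  assumes mono: "mono_on {a..b} g" and "a \<le> b" and "s > 0"
    and steep: "\<And>x d. x \<in> S \<Longrightarrow> d > 0 \<Longrightarrow>
      \<exists>u v. a \<le> u \<and> u \<le> x \<and> x \<le> v \<and> v \<le> b \<and> 0 < v - u \<and> v - u < d \<and>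
        g v - g u \<ge> s * (v - u)"
  obtains U where "S \<subseteq> U" "U \<in> lmeasurable" "s * measure lebesgue U \<le> g b - g a"
proof -
  define K where "K = {(u, v). a \<le> u \<and> u < v \<and> v \<le> b \<and> g v - g u \<ge> s * (v - u)}"
  define c :: "real \<times> real \<Rightarrow> real" where "c = (\<lambda>(u, v). (u + v) / 2)"
  define r :: "real \<times> real \<Rightarrow> real" where "r = (\<lambda>(u, v). (v - u) / 2)"
  have cb: "cball (c i) (r i) = {fst i..snd i}" for i
    by (auto simp: c_def r_def cball_eq_atLeastAtMost split: prod.splits) (simp_all add: field_simps)
  obtain C where C: "countable C" "C \<subseteq> K"
     and dj: "pairwise (\<lambda>i j. disjnt (cball (c i) (r i)) (cball (c j) (r j))) C"
     and neg: "negligible (S - (\<Union>i\<in>C. cball (c i) (r i)))"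
  proof (rule Vitali_covering_theorem_cballs[of K r S c])
    show "0 < r i" if "i \<in> K" for i using that by (auto simp: K_def r_def)
    show "\<exists>i. i \<in> K \<and> x \<in> cball (c i) (r i) \<and> r i < d" if "x \<in> S" "0 < d" for x d
    proof -
      from steep[OF that] obtain u v where "a \<le> u" "u \<le> x" "x \<le> v" "v \<le> b" "0 < v - u" "v - u < d"
        "g v - g u \<ge> s * (v - u)" by blast
      then show ?thesis using \<open>0 < d\<close> unfolding cb
        by (intro exI[of _ "(u, v)"]) (auto simp: K_def r_def)
    qed
  qed auto
  define I :: "real \<times> real \<Rightarrow> real set" where "I = (\<lambda>i. {fst i..snd i})"
  have meas: "I i \<in> lmeasurable" for i by (simp add: I_def)
  have bound: "measure lebesgue (\<Union>i\<in>F. I i) \<le> (g b - g a) / s" if "F \<subseteq> C" "finite F" for F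
  proof -
    have K: "a \<le> fst i \<and> fst i < snd i \<and> snd i \<le> b \<and> g (snd i) - g (fst i) \<ge> s * (snd i - fst i)"
      if "i \<in> F" for i
      using that \<open>F \<subseteq> C\<close> C(2) by (auto simp: K_def)
    have "s * measure lebesgue (\<Union>i\<in>F. I i) \<le> s * (\<Sum>i\<in>F. measure lebesgue (I i))"
      using \<open>s > 0\<close> by (intro mult_left_mono measure_UNION_le) (auto simp: that I_def)
    also have "\<dots> = (\<Sum>i\<in>F. s * (snd i - fst i))"
      unfolding sum_distrib_left by (intro sum.cong refl) (use K in \<open>force simp: I_def\<close>)
    also have "\<dots> \<le> (\<Sum>i\<in>F. g (snd i) - g (fst i))"
      using K by (intro sum_mono) auto
    also have "\<dots> \<le> g b - g a"
    proof (rule mono_on_sum_disjoint_intervals_le[OF \<open>finite F\<close> mono \<open>a \<le> b\<close>])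
      show "pairwise (\<lambda>i j. disjnt {fst i..snd i} {fst j..snd j}) F"
        using dj that(1) unfolding cb by (rule pairwise_subset)
    qed (use K in force)
    finally show ?thesis using \<open>s > 0\<close> by (simp add: field_simps)
  qed
  define N where "N = S - (\<Union>i\<in>C. I i)"
  have N: "N \<in> null_sets lebesgue"
    using neg unfolding cb N_def I_def by (simp add: negligible_iff_null_sets)
  then have N': "N \<in> lmeasurable"
    by (simp add: negligible_imp_measurable negligible_iff_null_sets)
  have lm: "(\<Union>i\<in>C. I i) \<in> lmeasurable" and le: "measure lebesgue (\<Union>i\<in>C. I i) \<le> (g b - g a) / s"
    using fmeasurable_UN_bound[OF C(1), of I, OF meas bound]
      measure_UN_bound[OF C(1), of I, OF meas bound] by auto
  show thesis
  proof (rule that)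
    show "S \<subseteq> (\<Union>i\<in>C. I i) \<union> N" by (auto simp: N_def)
    show "(\<Union>i\<in>C. I i) \<union> N \<in> lmeasurable"
      using lm N' by (rule fmeasurable.Un)
    have "measure lebesgue ((\<Union>i\<in>C. I i) \<union> N) = measure lebesgue (\<Union>i\<in>C. I i)"
      using N lm by (simp add: measure_Un_null_set fmeasurableD)
    then show "s * measure lebesgue ((\<Union>i\<in>C. I i) \<union> N) \<le> g b - g a"
      using le \<open>s > 0\<close> by (simp add: field_simps)
  qed
qed

text \<open>A set that occupies at most a fixed fraction \<open>\<kappa> < 1\<close> of every interval is null.\<close>

lemma negligible_if_density_bounded:
  fixes E :: "real set"
  assumes E: "E \<subseteq> {a<..<b}" and "\<kappa> < 1" "0 \<le> \<kappa>"
    and dens: "\<And>u v. a \<le> u \<Longrightarrow> u < v \<Longrightarrow> v \<le> b \<Longrightarrow>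
      \<exists>U. E \<inter> {u<..<v} \<subseteq> U \<and> U \<in> lmeasurable \<and> measure lebesgue U \<le> \<kappa> * (v - u)"
  shows "negligible E"
proof -
  \<comment> \<open>\<open>m = Inf A\<close> is the outer measure of \<open>E\<close>\<close>
  define A where "A = {measure lebesgue U | U. E \<subseteq> U \<and> U \<in> lmeasurable}"
  have "measure lebesgue {a<..<b} \<in> A" using E by (auto simp: A_def intro!: exI[of _ "{a<..<b}"])
  then have ne: "A \<noteq> {}" by auto
  have bdd: "bdd_below A" by (auto simp: A_def bdd_below_def intro!: exI[of _ 0])
  define m where "m = Inf A"
  have m0: "0 \<le> m" unfolding m_def by (rule cInf_greatest[OF ne]) (auto simp: A_def)
  have step: "m \<le> \<kappa> * (m + e)" if "e > 0" for e
  proof -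
    \<comment> \<open>cover \<open>E\<close> by disjoint intervals inside an open set of almost minimal measure and apply the
      density bound in each of them\<close>
    obtain U where U: "E \<subseteq> U" "U \<in> lmeasurable" "measure lebesgue U < m + e / 2"
    proof -
      have "Inf A < m + e / 2" using \<open>e > 0\<close> by (simp add: m_def)
      then obtain y where "y \<in> A" "y < m + e / 2" using cInf_lessD[OF ne] by blast
      then show thesis using that by (auto simp: A_def)
    qed
    obtain T where T: "open T" "U \<subseteq> T" "T - U \<in> lmeasurable" "emeasure lebesgue (T - U) < ennreal (e / 2)"
      using sets_lebesgue_outer_open[of U "e / 2"] U(2) \<open>e > 0\<close> by (auto simp: fmeasurableD)
    have mT: "measure lebesgue (T - U) < e / 2"
      using T(3,4) \<open>e > 0\<close> by (simp add: emeasure_eq_measure2 ennreal_less_iff)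
    have T_eq: "T = U \<union> (T - U)" using T(2) by auto
    have lmT: "T \<in> lmeasurable" using U(2) T(3) T_eq by (metis fmeasurable.Un)
    have T_less: "measure lebesgue T < m + e"
    proof -
      have "measure lebesgue T \<le> measure lebesgue U + measure lebesgue (T - U)"
        using measure_Un_le[of U lebesgue "T - U"] U(2) T(3) T_eq by (auto simp: fmeasurableD)
      then show ?thesis using U(3) mT by linarith
    qed
    define K where "K = {(u, v). a \<le> u \<and> u < v \<and> v \<le> b \<and> {u<..<v} \<subseteq> T}"
    define c :: "real \<times> real \<Rightarrow> real" where "c = (\<lambda>(u, v). (u + v) / 2)"
    define r :: "real \<times> real \<Rightarrow> real" where "r = (\<lambda>(u, v). (v - u) / 2)"
    have cb: "ball (c i) (r i) = {fst i<..<snd i}" for i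
      by (auto simp: c_def r_def ball_eq_greaterThanLessThan split: prod.splits) (simp_all add: field_simps)
    obtain C where C: "countable C" "C \<subseteq> K"
       and dj: "pairwise (\<lambda>i j. disjnt (ball (c i) (r i)) (ball (c j) (r j))) C"
       and neg: "negligible (E - (\<Union>i\<in>C. ball (c i) (r i)))"
    proof (rule Vitali_covering_theorem_balls[of E K c r])
      show "\<exists>i. i \<in> K \<and> x \<in> ball (c i) (r i) \<and> r i < d" if x: "x \<in> E" "0 < d" for x d
      proof -
        have "x \<in> T \<inter> {a<..<b}" "open (T \<inter> {a<..<b})" using x E U(1) T(1,2) by auto
        then obtain \<rho> where \<rho>: "\<rho> > 0" "ball x \<rho> \<subseteq> T \<inter> {a<..<b}"
          unfolding open_contains_ball by blast
        define h where "h = min (\<rho> / 2) (d / 2)"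
        have h: "h > 0" "h < \<rho>" "h < d" using \<rho> x by (auto simp: h_def)
        have sub: "{x - h..x + h} \<subseteq> T \<inter> {a<..<b}"
          using \<rho>(2) h by (auto simp: subset_iff dist_real_def)
        have "x - h \<in> {a<..<b}" "x + h \<in> {a<..<b}" using sub h by (auto simp: subset_iff)
        moreover have "{x - h<..<x + h} \<subseteq> T" using sub by (auto simp: subset_iff)
        ultimately show ?thesis using h unfolding cb
          by (intro exI[of _ "(x - h, x + h)"]) (auto simp: K_def r_def)
      qed
    qed auto
    define I :: "real \<times> real \<Rightarrow> real set" where "I = (\<lambda>i. {fst i<..<snd i})"
    have "\<exists>W. E \<inter> I i \<subseteq> W \<and> W \<in> lmeasurable \<and> measure lebesgue W \<le> \<kappa> * (snd i - fst i)"
      if "i \<in> C" for i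
      using that C(2) unfolding I_def by (intro dens) (auto simp: K_def)
    then obtain W where W: "\<And>i. i \<in> C \<Longrightarrow> E \<inter> I i \<subseteq> W i" "\<And>i. i \<in> C \<Longrightarrow> W i \<in> lmeasurable"
      "\<And>i. i \<in> C \<Longrightarrow> measure lebesgue (W i) \<le> \<kappa> * (snd i - fst i)"
      by metis
    have bound: "measure lebesgue (\<Union>i\<in>F. W i) \<le> \<kappa> * measure lebesgue T"
      if F: "F \<subseteq> C" "finite F" for F
    proof -
      have "measure lebesgue (\<Union>i\<in>F. W i) \<le> (\<Sum>i\<in>F. measure lebesgue (W i))"
        using F W(2) by (intro measure_UNION_le) (auto simp: fmeasurableD)
      also have "\<dots> \<le> (\<Sum>i\<in>F. \<kappa> * (snd i - fst i))" using F W(3) by (intro sum_mono) auto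
      also have "\<dots> = \<kappa> * (\<Sum>i\<in>F. measure lebesgue (I i))"
        unfolding sum_distrib_left
        by (intro sum.cong refl) (use F C(2) in \<open>force simp: I_def K_def\<close>)
      also have "(\<Sum>i\<in>F. measure lebesgue (I i)) = measure lebesgue (\<Union>i\<in>F. I i)"
      proof (rule measure_UNION'[symmetric, OF F(2)])
        show "pairwise (\<lambda>i j. disjnt (I i) (I j)) F"
          using dj F(1) unfolding cb I_def by (rule pairwise_subset)
      qed (simp add: I_def)
      also have "\<kappa> * \<dots> \<le> \<kappa> * measure lebesgue T"
      proof (intro mult_left_mono measure_mono_fmeasurable)
        show "(\<Union>i\<in>F. I i) \<subseteq> T" using F C(2) by (fastforce simp: I_def K_def)
        show "(\<Union>i\<in>F. I i) \<in> sets lebesgue" using F by (auto simp: I_def)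
      qed (use lmT \<open>0 \<le> \<kappa>\<close> in auto)
      finally show ?thesis .
    qed
    define N where "N = E - (\<Union>i\<in>C. I i)"
    have N: "N \<in> null_sets lebesgue"
      using neg unfolding cb N_def I_def by (simp add: negligible_iff_null_sets)
    then have N': "N \<in> lmeasurable"
      by (simp add: negligible_imp_measurable negligible_iff_null_sets)
    have lm: "(\<Union>i\<in>C. W i) \<in> lmeasurable" and le: "measure lebesgue (\<Union>i\<in>C. W i) \<le> \<kappa> * measure lebesgue T"
      using fmeasurable_UN_bound[OF C(1), of W, OF W(2) bound]
        measure_UN_bound[OF C(1), of W, OF W(2) bound] by auto
    have "E \<subseteq> (\<Union>i\<in>C. W i) \<union> N"
    proof
      fix x assume "x \<in> E"
      then show "x \<in> (\<Union>i\<in>C. W i) \<union> N"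
        using W(1) by (cases "x \<in> (\<Union>i\<in>C. I i)") (auto simp: N_def)
    qed
    then have "measure lebesgue ((\<Union>i\<in>C. W i) \<union> N) \<in> A"
      unfolding A_def using fmeasurable.Un[OF lm N'] by blast
    then have "m \<le> measure lebesgue ((\<Union>i\<in>C. W i) \<union> N)"
      unfolding m_def by (rule cInf_lower[OF _ bdd])
    also have "\<dots> = measure lebesgue (\<Union>i\<in>C. W i)"
      using N lm by (simp add: measure_Un_null_set fmeasurableD)
    also have "\<dots> \<le> \<kappa> * (m + e)"
      using le T_less \<open>0 \<le> \<kappa>\<close> by (meson less_imp_le mult_left_mono order_trans)
    finally show ?thesis .
  qed
  have "m \<le> \<kappa> * m"
  proof (rule field_le_epsilon)
    fix e :: real assume "e > 0"
    have "\<kappa> * (m + e) \<le> \<kappa> * m + e"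
      using \<open>e > 0\<close> \<open>\<kappa> < 1\<close> by (simp add: distrib_left)
    then show "m \<le> \<kappa> * m + e" using step[OF \<open>e > 0\<close>] by linarith
  qed
  then have "(1 - \<kappa>) * m \<le> 0" by (simp add: algebra_simps)
  then have "m = 0" using m0 \<open>\<kappa> < 1\<close> by (simp add: mult_le_0_iff)
  show ?thesis unfolding negligible_outer
  proof (intro allI impI)
    fix e :: real assume "e > 0"
    then have "Inf A < e" using \<open>m = 0\<close> by (simp add: m_def)
    then obtain y where "y \<in> A" "y < e" using cInf_lessD[OF ne] by blast
    then show "\<exists>T. E \<subseteq> T \<and> T \<in> lmeasurable \<and> measure lebesgue T < e" by (auto simp: A_def)
  qed
qed

section \<open>Almost everywhere differentiability and the mean value inequality\<close>

text \<open>Some chord of \<open>f\<close> over an arbitrarily short interval around \<open>x\<close> has a slope satisfying \<open>R\<close>.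
  The point \<open>x\<close> may be an end of the interval, so all four Dini derivates are covered.\<close>

definition short_chord :: "(real \<Rightarrow> real) \<Rightarrow> real \<Rightarrow> (real \<Rightarrow> bool) \<Rightarrow> bool" where
  "short_chord f x R \<longleftrightarrow> (\<forall>d>0. \<exists>u v. u \<le> x \<and> x \<le> v \<and> 0 < v - u \<and> v - u < d \<and>
     R ((f v - f u) / (v - u)))"

lemma short_chordE:
  assumes "short_chord f x R" "a < x" "x < b" "d > 0"
  obtains u v where "a \<le> u" "u \<le> x" "x \<le> v" "v \<le> b" "0 < v - u" "v - u < d"
    "R ((f v - f u) / (v - u))"
proof -
  define d' where "d' = min d (min (x - a) (b - x))"
  have "d' > 0" using assms by (simp add: d'_def)
  then obtain u v where "u \<le> x" "x \<le> v" "0 < v - u" "v - u < d'" "R ((f v - f u) / (v - u))"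
    using assms(1) unfolding short_chord_def by blast
  then show thesis by (intro that[of u v]) (auto simp: d'_def)
qed

lemma short_chord_if_frequently:
  assumes "\<exists>\<^sub>F h in at 0. R ((f (x + h) - f x) / h)"
  shows "short_chord f x R"
  unfolding short_chord_def
proof (intro allI impI)
  fix d :: real assume "d > 0"
  have "\<forall>\<^sub>F h in at (0::real). h \<noteq> 0 \<and> \<bar>h\<bar> < d"
    using \<open>d > 0\<close> by (auto simp: eventually_at dist_real_def)
  then have "\<exists>\<^sub>F h in at 0. R ((f (x + h) - f x) / h) \<and> h \<noteq> 0 \<and> \<bar>h\<bar> < d"
    using assms by (rule frequently_eventually_frequently[rotated])
  then obtain h where h: "R ((f (x + h) - f x) / h)" "h \<noteq> 0" "\<bar>h\<bar> < d"
    using frequently_ex by blast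
  show "\<exists>u v. u \<le> x \<and> x \<le> v \<and> 0 < v - u \<and> v - u < d \<and> R ((f v - f u) / (v - u))"
  proof (cases "h > 0")
    case True
    then show ?thesis using h by (intro exI[of _ x] exI[of _ "x + h"]) auto
  next
    case False
    have "(f x - f (x + h)) / (x - (x + h)) = (f (x + h) - f x) / h"
      using h(2) by (simp add: field_simps)
    then show ?thesis using False h by (intro exI[of _ "x + h"] exI[of _ x]) auto
  qed
qed

lemma lipschitz_on_abs_diff_le:
  fixes f :: "real \<Rightarrow> real"
  assumes "L-lipschitz_on S f" "x \<in> S" "y \<in> S"
  shows "\<bar>f x - f y\<bar> \<le> L * \<bar>x - y\<bar>"
  using lipschitz_onD[OF assms] by (simp add: dist_real_def)

lemma lipschitz_eventually_difference_quotient_le: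
  fixes f :: "real \<Rightarrow> real"
  assumes lip: "L-lipschitz_on {a..b} f" and x: "a < x" "x < b"
  shows "\<forall>\<^sub>F h in at 0. \<bar>(f (x + h) - f x) / h\<bar> \<le> L"
proof -
  have "\<forall>\<^sub>F h in at (0::real). h \<noteq> 0 \<and> \<bar>h\<bar> < min (x - a) (b - x)"
    using x unfolding eventually_at by (intro exI[of _ "min (x - a) (b - x)"]) (auto simp: dist_real_def)
  then show ?thesis
  proof (rule eventually_mono)
    fix h assume h: "h \<noteq> 0 \<and> \<bar>h\<bar> < min (x - a) (b - x)"
    then have "\<bar>f (x + h) - f x\<bar> \<le> L * \<bar>x + h - x\<bar>"
      by (intro lipschitz_on_abs_diff_le[OF lip]) auto
    then show "\<bar>(f (x + h) - f x) / h\<bar> \<le> L" using h by (simp add: abs_divide pos_divide_le_eq)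
  qed
qed

lemma lipschitz_abs_deriv_le:
  fixes f :: "real \<Rightarrow> real"
  assumes lip: "L-lipschitz_on {a..b} f" and x: "a < x" "x < b" and "f differentiable (at x)"
  shows "\<bar>deriv f x\<bar> \<le> L"
proof (rule tendsto_upperbound)
  have "(f has_field_derivative deriv f x) (at x)"
    using assms(4) by (simp add: DERIV_deriv_iff_real_differentiable)
  then show "((\<lambda>h. \<bar>(f (x + h) - f x) / h\<bar>) \<longlongrightarrow> \<bar>deriv f x\<bar>) (at 0)"
    unfolding DERIV_def by (rule tendsto_rabs)
qed (use lipschitz_eventually_difference_quotient_le[OF lip x] in auto)

lemma lipschitz_on_mono_on_linear_minus:
  fixes f :: "real \<Rightarrow> real"
  assumes "L-lipschitz_on S f" "L \<le> K"
  shows "mono_on S (\<lambda>x. K * x - f x)"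
proof (rule mono_onI)
  fix x y assume "x \<in> S" "y \<in> S" "x \<le> y"
  then have "\<bar>f y - f x\<bar> \<le> L * (y - x)" using lipschitz_on_abs_diff_le[OF assms(1), of y x] by simp
  also have "\<dots> \<le> K * (y - x)" using assms \<open>x \<le> y\<close> by (simp add: mult_right_mono)
  finally show "K * x - f x \<le> K * y - f y" by (simp add: algebra_simps)
qed

text \<open>The growth lemma applied to the nondecreasing function \<open>K * x - f x\<close>, which is steep where
  \<open>f\<close> has short chords of slope at most \<open>p\<close>.\<close>

lemma lipschitz_flat_set_outer_measure_le:
  fixes f :: "real \<Rightarrow> real"
  assumes lip: "L-lipschitz_on {a..b} f" and "a \<le> b" and "L \<le> K" "p < K"
    and S: "S \<subseteq> {a<..<b}" and flat: "\<And>x. x \<in> S \<Longrightarrow> short_chord f x (\<lambda>s. s \<le> p)"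
  obtains U where "S \<subseteq> U" "U \<in> lmeasurable"
    "(K - p) * measure lebesgue U \<le> K * (b - a) - (f b - f a)"
proof -
  obtain U where U: "S \<subseteq> U" "U \<in> lmeasurable"
    "(K - p) * measure lebesgue U \<le> (K * b - f b) - (K * a - f a)"
  proof (rule mono_on_steep_set_outer_measure_le[of a b "\<lambda>x. K * x - f x" "K - p" S])
    show "mono_on {a..b} (\<lambda>x. K * x - f x)"
      by (rule lipschitz_on_mono_on_linear_minus[OF lip \<open>L \<le> K\<close>])
    fix x d :: real assume "x \<in> S" "d > 0"
    then have "short_chord f x (\<lambda>s. s \<le> p)" "a < x" "x < b" using flat S by auto
    from short_chordE[OF this \<open>d > 0\<close>] obtain u v where
      uv: "a \<le> u" "u \<le> x" "x \<le> v" "v \<le> b" "0 < v - u" "v - u < d" "(f v - f u) / (v - u) \<le> p" .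
    then have "f v - f u \<le> p * (v - u)" by (simp add: pos_divide_le_eq)
    then have "(K - p) * (v - u) \<le> (K * v - f v) - (K * u - f u)" by (simp add: algebra_simps)
    with uv show "\<exists>u v. a \<le> u \<and> u \<le> x \<and> x \<le> v \<and> v \<le> b \<and> 0 < v - u \<and> v - u < d \<and>
        (K - p) * (v - u) \<le> (K * v - f v) - (K * u - f u)" by blast
  qed (use assms in auto)
  then show thesis using that by (simp add: algebra_simps)
qed

text \<open>Where short chords have slopes both below \<open>p\<close> and above \<open>q > p\<close>, the two growth estimates
  on an interval compete: whatever the increment of \<open>f\<close>, the set misses a fixed fraction of it.\<close>

lemma negligible_straddling_chords:
  fixes f :: "real \<Rightarrow> real"
  assumes lip: "L-lipschitz_on {a..b} f" and "p < q"
  shows "negligible {x \<in> {a<..<b}. short_chord f x (\<lambda>s. s \<le> p) \<and> short_chord f x (\<lambda>s. s \<ge> q)}"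
    (is "negligible ?E")
proof -
  define K where "K = L + \<bar>p\<bar> + \<bar>q\<bar> + 1"
  have K: "L \<le> K" "p < K" "- q < K" "0 < K" using lipschitz_on_nonneg[OF lip] by (auto simp: K_def)
  have den: "2 * K + q - p > 0" using K by linarith
  define \<kappa> where "\<kappa> = 2 * K / (2 * K + q - p)"
  show ?thesis
  proof (rule negligible_if_density_bounded)
    show "?E \<subseteq> {a<..<b}" by auto
    show "\<kappa> < 1" "0 \<le> \<kappa>" using K den \<open>p < q\<close> by (auto simp: \<kappa>_def)
    fix u v assume uv: "a \<le> u" "u < v" "v \<le> b"
    let ?S = "?E \<inter> {u<..<v}"
    have lip_uv: "L-lipschitz_on {u..v} f" by (rule lipschitz_on_subset[OF lip]) (use uv in auto)
    then have lip_uv': "L-lipschitz_on {u..v} (\<lambda>x. - f x)"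
      by (simp add: lipschitz_on_def dist_real_def abs_minus_commute)
    obtain U where U: "?S \<subseteq> U" "U \<in> lmeasurable"
      "(K - p) * measure lebesgue U \<le> K * (v - u) - (f v - f u)"
      by (rule lipschitz_flat_set_outer_measure_le[OF lip_uv, of K p ?S]) (use K uv in auto)
    have neg: "short_chord (\<lambda>x. - f x) x (\<lambda>s. s \<le> - q)" if "x \<in> ?S" for x
    proof -
      have "short_chord f x (\<lambda>s. s \<ge> q)" using that by simp
      moreover have "((- f v) - (- f u)) / (v - u) = - ((f v - f u) / (v - u))" for u v
        by (simp add: minus_divide_left)
      ultimately show ?thesis unfolding short_chord_def by (simp only: neg_le_iff_le)
    qed
    obtain V where V: "?S \<subseteq> V" "V \<in> lmeasurable"
      "(K - (- q)) * measure lebesgue V \<le> K * (v - u) - ((- f v) - (- f u))"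
      by (rule lipschitz_flat_set_outer_measure_le[OF lip_uv', of K "- q" ?S])
        (use K uv neg in auto)
    have W: "U \<inter> V \<in> lmeasurable" using U V by blast
    have "(K - p) * measure lebesgue (U \<inter> V) \<le> (K - p) * measure lebesgue U"
      "(K + q) * measure lebesgue (U \<inter> V) \<le> (K + q) * measure lebesgue V"
      using K U V W by (auto intro!: mult_left_mono measure_mono_fmeasurable simp: fmeasurableD)
    then have "(2 * K + q - p) * measure lebesgue (U \<inter> V) \<le> 2 * K * (v - u)"
      using U(3) V(3) by (simp add: algebra_simps)
    then have "measure lebesgue (U \<inter> V) \<le> \<kappa> * (v - u)"
      using den by (simp add: \<kappa>_def pos_le_divide_eq mult.commute)
    then show "\<exists>U. ?S \<subseteq> U \<and> U \<in> lmeasurable \<and> measure lebesgue U \<le> \<kappa> * (v - u)"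
      using U(1) V(1) W by (intro exI[of _ "U \<inter> V"] conjI Int_greatest) 
  qed
qed

text \<open>If no two rationals separate the slopes of short chords, the difference quotient has equal
  lower and upper limits, which are finite by the Lipschitz condition.\<close>

lemma lipschitz_differentiable_if_chords_agree:
  fixes f :: "real \<Rightarrow> real"
  assumes lip: "L-lipschitz_on {a..b} f" and x: "a < x" "x < b"
    and agree: "\<And>p q :: rat. p < q \<Longrightarrow>
      \<not> (short_chord f x (\<lambda>s. s \<le> real_of_rat p) \<and> short_chord f x (\<lambda>s. s \<ge> real_of_rat q))"
  shows "f differentiable (at x)"
proof -
  define D where "D = (\<lambda>h. (f (x + h) - f x) / h)"
  let ?lo = "Liminf (at 0) (\<lambda>h. ereal (D h))" and ?hi = "Limsup (at 0) (\<lambda>h. ereal (D h))"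
  have "?lo \<le> ?hi" by (rule Liminf_le_Limsup) simp
  moreover have "\<not> ?lo < ?hi"
  proof
    assume "?lo < ?hi"
    then obtain p where p: "?lo < ereal (real_of_rat p)" "ereal (real_of_rat p) < ?hi"
      using ereal_dense3 by blast
    from ereal_dense3[OF p(2)] obtain q where
      q: "ereal (real_of_rat p) < ereal (real_of_rat q)" "ereal (real_of_rat q) < ?hi" by blast
    have "\<exists>\<^sub>F h in at 0. D h \<le> real_of_rat p"
    proof (rule ccontr)
      assume "\<not> ?thesis"
      then have "\<forall>\<^sub>F h in at 0. ereal (real_of_rat p) \<le> ereal (D h)"
        by (auto simp: not_frequently elim: eventually_mono)
      from Liminf_bounded[OF this] p(1) show False by simp
    qed
    moreover have "\<exists>\<^sub>F h in at 0. D h \<ge> real_of_rat q"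
    proof (rule ccontr)
      assume "\<not> ?thesis"
      then have "\<forall>\<^sub>F h in at 0. ereal (D h) \<le> ereal (real_of_rat q)"
        by (auto simp: not_frequently elim: eventually_mono)
      from Limsup_bounded[OF this] q(2) show False by simp
    qed
    ultimately show False
      using agree[of p q] q(1) short_chord_if_frequently unfolding D_def
      by (fastforce simp: of_rat_less)
  qed
  ultimately have eq: "?lo = ?hi" by simp
  have near: "\<forall>\<^sub>F h in at 0. \<bar>D h\<bar> \<le> L"
    unfolding D_def using lip x by (rule lipschitz_eventually_difference_quotient_le)
  have "ereal (- L) \<le> ?lo" by (rule Liminf_bounded) (use near in \<open>auto elim: eventually_mono\<close>)
  moreover have "?hi \<le> ereal L" by (rule Limsup_bounded) (use near in \<open>auto elim: eventually_mono\<close>)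
  ultimately obtain l where l: "?lo = ereal l" using eq by (metis ereal_infty_less_eq(1,2) ereal_less_eq(1,2) MInfty_neq_ereal(1) PInfty_neq_ereal(1) ereal_cases)
  have "((\<lambda>h. ereal (D h)) \<longlongrightarrow> ereal l) (at 0)"
    using eq l by (subst tendsto_iff_Liminf_eq_Limsup) auto
  then have "(D \<longlongrightarrow> l) (at 0)" by simp
  then have "(f has_field_derivative l) (at x)" by (simp add: D_def DERIV_def)
  then show ?thesis using real_differentiable_def by blast
qed

text \<open>The mean value inequality for Lipschitz functions needs the bound only at the points of
  differentiability, because these are almost all points.\<close>

theorem lipschitz_increment_le:
  fixes f :: "real \<Rightarrow> real"
  assumes lip: "L-lipschitz_on {a..b} f" and "a \<le> b"
    and deriv_le: "\<And>c. a < c \<Longrightarrow> c < b \<Longrightarrow> f differentiable (at c) \<Longrightarrow> deriv f c \<le> M"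
  shows "f b - f a \<le> M * (b - a)"
proof -
  define E where "E = (\<lambda>(p, q). {x \<in> {a<..<b}. short_chord f x (\<lambda>s. s \<le> real_of_rat p) \<and>
    short_chord f x (\<lambda>s. s \<ge> real_of_rat q)})"
  define N where "N = (\<Union>pq\<in>{(p, q). p < q}. E pq)"
  have "negligible N" unfolding N_def
    using negligible_straddling_chords[OF lip]
    by (intro negligible_countable_Union) (auto simp: E_def of_rat_less)
  have diff: "f differentiable (at x)" if "x \<in> {a<..<b} - N" for x
    by (rule lipschitz_differentiable_if_chords_agree[OF lip]) (use that in \<open>auto simp: N_def E_def\<close>)
  show ?thesis
  proof (rule field_le_epsilon)
    fix e' :: real assume "e' > 0"
    define e where "e = e' / (b - a + 1)"
    have "e > 0" "e * (b - a) \<le> e'" using \<open>e' > 0\<close> \<open>a \<le> b\<close> by (auto simp: e_def field_simps)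
    define K where "K = L + \<bar>M\<bar> + e + 1"
    have K: "L \<le> K" "M + e < K" using lipschitz_on_nonneg[OF lip] \<open>e > 0\<close> by (auto simp: K_def)
    have chord: "short_chord f x (\<lambda>s. s \<le> M + e)" if x: "x \<in> {a<..<b} - N" for x
    proof (rule short_chord_if_frequently)
      have "(f has_field_derivative deriv f x) (at x)"
        using diff[OF x] by (simp add: DERIV_deriv_iff_real_differentiable)
      then have "((\<lambda>h. (f (x + h) - f x) / h) \<longlongrightarrow> deriv f x) (at 0)" by (simp add: DERIV_def)
      moreover have "deriv f x < M + e" using deriv_le[of x] diff[OF x] x \<open>e > 0\<close> by auto
      ultimately have "\<forall>\<^sub>F h in at 0. (f (x + h) - f x) / h < M + e" by (rule order_tendstoD)
      then have "\<forall>\<^sub>F h in at 0. (f (x + h) - f x) / h \<le> M + e" by (auto elim: eventually_mono)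
      then show "\<exists>\<^sub>F h in at 0. (f (x + h) - f x) / h \<le> M + e"
        by (rule eventually_frequently[rotated]) simp
    qed
    obtain U where U: "{a<..<b} - N \<subseteq> U" "U \<in> lmeasurable"
      "(K - (M + e)) * measure lebesgue U \<le> K * (b - a) - (f b - f a)"
      by (rule lipschitz_flat_set_outer_measure_le[OF lip \<open>a \<le> b\<close> K, of "{a<..<b} - N"])
        (use chord in auto)
    have "b - a \<le> measure lebesgue U"
    proof -
      have "b - a = measure lebesgue {a<..<b}" using \<open>a \<le> b\<close> by simp
      also have "\<dots> \<le> measure lebesgue (U \<union> N)"
        using U(1) fmeasurable.Un[OF U(2) negligible_imp_measurable[OF \<open>negligible N\<close>]]
        by (intro measure_mono_fmeasurable) auto
      also have "\<dots> = measure lebesgue U"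
        using U(2) \<open>negligible N\<close> by (simp add: measure_Un_null_set fmeasurableD negligible_iff_null_sets)
      finally show ?thesis .
    qed
    then have "(K - (M + e)) * (b - a) \<le> K * (b - a) - (f b - f a)"
      using U(3) K(2) by (meson diff_ge_0_iff_ge less_imp_le mult_left_mono order_trans)
    then have "f b - f a \<le> M * (b - a) + e * (b - a)" by (simp add: algebra_simps)
    then show "f b - f a \<le> M * (b - a) + e'" using \<open>e * (b - a) \<le> e'\<close> by linarith
  qed
qed

corollary lipschitz_increment_approx:
  fixes f :: "real \<Rightarrow> real"
  assumes lip: "L-lipschitz_on {a..b} f" and "a \<le> b"
    and deriv: "\<And>c. a < c \<Longrightarrow> c < b \<Longrightarrow> f differentiable (at c) \<Longrightarrow> \<bar>deriv f c - v\<bar> \<le> M"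
  shows "\<bar>f b - f a - v * (b - a)\<bar> \<le> M * (b - a)"
proof -
  have "f b - f a \<le> (v + M) * (b - a)"
    by (rule lipschitz_increment_le[OF lip \<open>a \<le> b\<close>]) (use deriv in force)
  moreover have "- f b - (- f a) \<le> (M - v) * (b - a)"
  proof (rule lipschitz_increment_le[OF _ \<open>a \<le> b\<close>, of L])
    show "L-lipschitz_on {a..b} (\<lambda>x. - f x)"
      using lip by (simp add: lipschitz_on_def dist_real_def abs_minus_commute)
    fix c assume c: "a < c" "c < b" "(\<lambda>x. - f x) differentiable (at c)"
    from differentiable_minus[OF c(3)] have d: "f differentiable (at c)" by simp
    then have "deriv (\<lambda>x. - f x) c = - deriv f c"
      by (intro DERIV_imp_deriv derivative_intros) (simp add: DERIV_deriv_iff_real_differentiable)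
    then show "deriv (\<lambda>x. - f x) c \<le> M - v" using deriv[OF c(1,2) d] by simp
  qed
  ultimately show ?thesis by (simp add: algebra_simps abs_le_iff)
qed

section \<open>Clarke Jacobian and strict derivatives\<close>

lemma lipschitz_chord_approx:
  fixes f :: "real \<Rightarrow> real"
  assumes lip: "L-lipschitz_on {min x y..max x y} f"
    and deriv: "\<And>c. min x y < c \<Longrightarrow> c < max x y \<Longrightarrow> f differentiable (at c) \<Longrightarrow> \<bar>deriv f c - v\<bar> \<le> M"
  shows "\<bar>f x - f y - v * (x - y)\<bar> \<le> M * \<bar>x - y\<bar>"
proof (cases "x \<le> y")
  case True
  have "\<bar>f y - f x - v * (y - x)\<bar> \<le> M * (y - x)"
    by (rule lipschitz_increment_approx[of L]) (use assms True in \<open>simp_all add: min_def max_def\<close>)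
  moreover have "\<bar>f y - f x - v * (y - x)\<bar> = \<bar>f x - f y - v * (x - y)\<bar>"
    by (subst abs_minus_commute) (simp add: algebra_simps)
  ultimately show ?thesis using True by simp
next
  case False
  have "\<bar>f x - f y - v * (x - y)\<bar> \<le> M * (x - y)"
    by (rule lipschitz_increment_approx[of L]) (use assms False in \<open>simp_all add: min_def max_def\<close>)
  then show ?thesis using False by simp
qed

lemma deriv_in_clarke_jacobian:
  assumes "f differentiable (at x)"
  shows "deriv f x \<in> clarke_jacobian f x"
  unfolding clarke_jacobian_def
  by (rule hull_inc) (use assms in \<open>auto intro!: exI[of _ "\<lambda>_. x"]\<close>)

lemma locally_lipschitzE:
  assumes "locally_lipschitz f"
  obtains u L where "u > 0" "L-lipschitz_on {z - u..z + u} f"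
  using assms unfolding locally_lipschitz_def
  by (metis cball_eq_atLeastAtMost)

text \<open>If this failed, derivatives at points tending to \<open>z\<close>, which are bounded by the Lipschitz constant,
  would accumulate at a second element of the Clarke Jacobian.\<close>

lemma clarke_singleton_deriv_close:
  assumes lip: "locally_lipschitz f" and clarke: "clarke_jacobian f z = {v}" and "\<epsilon> > 0"
  obtains \<delta> where "\<delta> > 0"
    "\<And>c. \<bar>c - z\<bar> < \<delta> \<Longrightarrow> f differentiable (at c) \<Longrightarrow> \<bar>deriv f c - v\<bar> \<le> \<epsilon>"
proof (rule ccontr)
  assume no: "\<not> thesis"
  obtain u L where uL: "u > 0" "L-lipschitz_on {z - u..z + u} f"
    using locally_lipschitzE[OF lip] .
  have "\<exists>c. \<bar>c - z\<bar> < min u (1 / real (Suc n)) \<and> f differentiable (at c) \<and> \<not> \<bar>deriv f c - v\<bar> \<le> \<epsilon>" for n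
  proof (rule ccontr)
    assume "\<not> ?thesis"
    with no that[of "min u (1 / real (Suc n))"] uL(1) show False by auto
  qed
  then obtain X where X: "\<And>n. \<bar>X n - z\<bar> < min u (1 / real (Suc n))"
    "\<And>n. f differentiable (at (X n))" "\<And>n. \<not> \<bar>deriv f (X n) - v\<bar> \<le> \<epsilon>"
    by metis
  have "\<bar>deriv f (X n)\<bar> \<le> L" for n
    using X(1)[of n] by (intro lipschitz_abs_deriv_le[OF uL(2) _ _ X(2)]) (auto simp: abs_less_iff)
  then have "bounded (range (\<lambda>n. deriv f (X n)))"
    by (auto simp: bounded_iff intro!: exI[of _ L])
  then obtain l and s :: "nat \<Rightarrow> nat" where s: "strict_mono s" "((\<lambda>n. deriv f (X n)) \<circ> s) \<longlonglongrightarrow> l"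
    using bounded_imp_convergent_subsequence by blast
  have "X \<longlonglongrightarrow> z"
  proof (rule metric_LIMSEQ_I)
    fix e :: real assume "e > 0"
    then obtain N where N: "1 / real (Suc N) < e" using nat_approx_posE by blast
    have "dist (X n) z < e" if "n \<ge> N" for n
    proof -
      have "1 / real (Suc n) \<le> 1 / real (Suc N)" using that by (simp add: field_simps)
      then show ?thesis using X(1)[of n] N by (simp add: dist_real_def)
    qed
    then show "\<exists>N. \<forall>n\<ge>N. dist (X n) z < e" by blast
  qed
  then have "(X \<circ> s) \<longlonglongrightarrow> z" using s(1) by (rule LIMSEQ_subseq_LIMSEQ)
  then have "l \<in> clarke_jacobian f z"
    unfolding clarke_jacobian_def using s(2) X(2)
    by (intro hull_inc) (auto simp: o_def intro!: exI[of _ "\<lambda>n. X (s n)"])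
  then have "l = v" using clarke by simp
  from s(2) have "\<forall>\<^sub>F n in sequentially. dist (deriv f (X (s n))) l < \<epsilon>"
    unfolding o_def using \<open>\<epsilon> > 0\<close> by (rule tendstoD)
  then obtain n where "dist (deriv f (X (s n))) l < \<epsilon>"
    using eventually_happens' sequentially_bot by blast
  then show False using X(3)[of "s n"] \<open>l = v\<close> by (simp add: dist_real_def)
qed

text \<open>A singleton Clarke Jacobian is a strict derivative.\<close>

lemma clarke_singleton_strict_derivative:
  assumes lip: "locally_lipschitz f" and clarke: "clarke_jacobian f z = {v}" and "\<epsilon> > 0"
  obtains \<delta> where "\<delta> > 0"
    "\<And>x y. \<bar>x - z\<bar> < \<delta> \<Longrightarrow> \<bar>y - z\<bar> < \<delta> \<Longrightarrow> \<bar>f x - f y - v * (x - y)\<bar> \<le> \<epsilon> * \<bar>x - y\<bar>"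
proof -
  obtain u L where uL: "u > 0" "L-lipschitz_on {z - u..z + u} f"
    using locally_lipschitzE[OF lip] .
  obtain \<delta> where \<delta>: "\<delta> > 0" "\<And>c. \<bar>c - z\<bar> < \<delta> \<Longrightarrow> f differentiable (at c) \<Longrightarrow> \<bar>deriv f c - v\<bar> \<le> \<epsilon>"
    using clarke_singleton_deriv_close[OF assms] by blast
  show thesis
  proof (rule that[of "min u \<delta>"])
    fix x y assume xy: "\<bar>x - z\<bar> < min u \<delta>" "\<bar>y - z\<bar> < min u \<delta>"
    show "\<bar>f x - f y - v * (x - y)\<bar> \<le> \<epsilon> * \<bar>x - y\<bar>"
    proof (rule lipschitz_chord_approx)
      show "L-lipschitz_on {min x y..max x y} f"
        by (rule lipschitz_on_subset[OF uL(2)]) (use xy in auto)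
    qed (use xy in \<open>auto intro: \<delta>(2)\<close>)
  qed (use uL \<delta> in auto)
qed

text \<open>The quotient \<open>f x / (x - z)\<close> has derivative \<open>(f' x - f x / (x - z)) / (x - z)\<close>, which strong
  semismoothness bounds. Hence it is Lipschitz on either side of \<open>z\<close>.\<close>

lemma quotient_lipschitz_if_strongly_semismooth:
  fixes f :: "real \<Rightarrow> real"
  assumes lip: "L-lipschitz_on {z - u..z + u} f" and "f z = 0"
    and deriv: "\<And>c. 0 < \<bar>c - z\<bar> \<Longrightarrow> \<bar>c - z\<bar> < u \<Longrightarrow> f differentiable (at c) \<Longrightarrow>
      \<bar>f c - deriv f c * (c - z)\<bar> \<le> M * \<bar>c - z\<bar>\<^sup>2"
    and x: "\<bar>x - z\<bar> < u" and y: "\<bar>y - z\<bar> < u" and same: "(x > z \<and> y > z) \<or> (x < z \<and> y < z)"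
  shows "\<bar>f x / (x - z) - f y / (y - z)\<bar> \<le> M * \<bar>x - y\<bar>"
proof -
  define g where "g = (\<lambda>x. f x / (x - z))"
  define r where "r = min \<bar>x - z\<bar> \<bar>y - z\<bar>"
  have "r > 0" using same by (auto simp: r_def)
  have L: "0 \<le> L" using lipschitz_on_nonneg[OF lip] .
  have near: "r \<le> \<bar>c - z\<bar> \<and> \<bar>c - z\<bar> < u" if "min x y \<le> c" "c \<le> max x y" for c
    using that same x y by (auto simp: r_def min_def max_def abs_if split: if_splits)
  have g_lip: "(2 * L / r)-lipschitz_on {min x y..max x y} g"
  proof (rule lipschitz_onI)
    fix s t assume "s \<in> {min x y..max x y}" "t \<in> {min x y..max x y}"
    then have st: "r \<le> \<bar>s - z\<bar>" "\<bar>s - z\<bar> < u" "r \<le> \<bar>t - z\<bar>" "\<bar>t - z\<bar> < u" using near by auto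
    then have nz: "s - z \<noteq> 0" "t - z \<noteq> 0" using \<open>r > 0\<close> by auto
    have fst: "\<bar>f s - f t\<bar> \<le> L * \<bar>s - t\<bar>" "\<bar>f t - f z\<bar> \<le> L * \<bar>t - z\<bar>"
      using st by (auto intro!: lipschitz_on_abs_diff_le[OF lip] simp: abs_less_iff)
    have "\<bar>(f s - f t) * (t - z) - f t * (s - t)\<bar> \<le> \<bar>f s - f t\<bar> * \<bar>t - z\<bar> + \<bar>f t\<bar> * \<bar>s - t\<bar>"
      by (metis abs_mult abs_triangle_ineq4)
    also have "\<dots> \<le> L * \<bar>s - t\<bar> * \<bar>t - z\<bar> + L * \<bar>t - z\<bar> * \<bar>s - t\<bar>"
      using fst \<open>f z = 0\<close> by (intro add_mono mult_right_mono) auto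
    finally have num: "\<bar>(f s - f t) * (t - z) - f t * (s - t)\<bar> \<le> 2 * L * \<bar>s - t\<bar> * \<bar>t - z\<bar>"
      by (simp add: algebra_simps)
    have "g s - g t = ((f s - f t) * (t - z) - f t * (s - t)) / ((s - z) * (t - z))"
      unfolding g_def using nz by (simp add: diff_frac_eq) (simp add: algebra_simps)
    then have "\<bar>g s - g t\<bar> \<le> 2 * L * \<bar>s - t\<bar> * \<bar>t - z\<bar> / (\<bar>s - z\<bar> * \<bar>t - z\<bar>)"
      using divide_right_mono[OF num, of "\<bar>s - z\<bar> * \<bar>t - z\<bar>"] by (simp only: abs_divide abs_mult) simp
    also have "\<dots> = 2 * L * \<bar>s - t\<bar> / \<bar>s - z\<bar>" using nz by simp
    also have "\<dots> \<le> 2 * L * \<bar>s - t\<bar> / r"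
      using st L \<open>r > 0\<close> by (intro divide_left_mono) auto
    finally show "dist (g s) (g t) \<le> 2 * L / r * dist s t" by (simp add: dist_real_def)
  qed (use L \<open>r > 0\<close> in auto)
  have "\<bar>g x - g y - 0 * (x - y)\<bar> \<le> M * \<bar>x - y\<bar>"
  proof (rule lipschitz_chord_approx[OF g_lip])
    fix c assume c: "min x y < c" "c < max x y" and "g differentiable (at c)"
    then have cz: "0 < \<bar>c - z\<bar>" "\<bar>c - z\<bar> < u" using near[of c] \<open>r > 0\<close> by auto
    then have "c \<noteq> z" by auto
    have Dg: "(g has_field_derivative deriv g c) (at c)"
      using \<open>g differentiable (at c)\<close> by (simp add: DERIV_deriv_iff_real_differentiable)
    have "((\<lambda>x. g x * (x - z)) has_field_derivative deriv g c * (c - z) + g c) (at c)"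
      by (rule derivative_eq_intros Dg refl | simp)+
    moreover have "(\<lambda>x. g x * (x - z)) = f" using \<open>f z = 0\<close> by (auto simp: g_def fun_eq_iff)
    ultimately have Df: "(f has_field_derivative deriv g c * (c - z) + g c) (at c)" by simp
    then have "\<bar>f c - (deriv g c * (c - z) + g c) * (c - z)\<bar> \<le> M * \<bar>c - z\<bar>\<^sup>2"
      using deriv[OF cz] real_differentiable_def by (metis DERIV_imp_deriv)
    moreover have "f c - (deriv g c * (c - z) + g c) * (c - z) = - (deriv g c * (c - z)\<^sup>2)"
      using \<open>c \<noteq> z\<close> by (simp add: g_def field_simps power2_eq_square)
    ultimately have "\<bar>deriv g c\<bar> * \<bar>c - z\<bar>\<^sup>2 \<le> M * \<bar>c - z\<bar>\<^sup>2"
      by (simp add: abs_mult)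
    then show "\<bar>deriv g c - 0\<bar> \<le> M" using cz(1) by simp
  qed
  then show ?thesis by (simp add: g_def)
qed

text \<open>Under strong semismoothness the slopes of chords near \<open>z\<close> approach \<open>v\<close> at a linear rate:
  the quotient \<open>f x / (x - z)\<close> tends to \<open>v\<close> and is Lipschitz on either side, derivatives differ from
  it by \<open>O(\<bar>x - z\<bar>)\<close>, and the mean value inequality passes from derivatives to chords.\<close>

lemma strongly_semismooth_chord_rate:
  assumes lip: "locally_lipschitz f" and "f z = 0" and clarke: "clarke_jacobian f z = {v}"
    and strong: "strongly_semismooth_at f z"
  obtains M \<delta> where "M \<ge> 0" "\<delta> > 0"
    "\<And>x y. \<bar>x - z\<bar> < \<delta> \<Longrightarrow> \<bar>y - z\<bar> < \<delta> \<Longrightarrow>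
      \<bar>f x - f y - v * (x - y)\<bar> \<le> M * max \<bar>x - z\<bar> \<bar>y - z\<bar> * \<bar>x - y\<bar>"
proof -
  obtain u L where uL: "u > 0" "L-lipschitz_on {z - u..z + u} f"
    using locally_lipschitzE[OF lip] .
  obtain M0 where "\<forall>\<^sub>F h in at 0. \<forall>V\<in>clarke_jacobian f (z + h).
        \<bar>f (z + h) - f z - V * h\<bar> \<le> M0 * \<bar>h\<bar>\<^sup>2"
    using strong unfolding strongly_semismooth_at_def by blast
  then obtain \<delta>0 where \<delta>0: "\<delta>0 > 0" "\<And>h V. h \<noteq> 0 \<Longrightarrow> \<bar>h\<bar> < \<delta>0 \<Longrightarrow> V \<in> clarke_jacobian f (z + h) \<Longrightarrow>
        \<bar>f (z + h) - f z - V * h\<bar> \<le> M0 * \<bar>h\<bar>\<^sup>2"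
    unfolding eventually_at by (auto simp: dist_real_def)
  define M where "M = max M0 0"
  define \<delta> where "\<delta> = min u \<delta>0"
  have "M \<ge> 0" "\<delta> > 0" using uL \<delta>0 by (auto simp: M_def \<delta>_def)
  have lip\<delta>: "L-lipschitz_on {z - \<delta>..z + \<delta>} f"
    by (rule lipschitz_on_subset[OF uL(2)]) (auto simp: \<delta>_def)
  have deriv: "\<bar>f c - deriv f c * (c - z)\<bar> \<le> M * \<bar>c - z\<bar>\<^sup>2"
    if "0 < \<bar>c - z\<bar>" "\<bar>c - z\<bar> < \<delta>" "f differentiable (at c)" for c
  proof -
    have "\<bar>f (z + (c - z)) - f z - deriv f c * (c - z)\<bar> \<le> M0 * \<bar>c - z\<bar>\<^sup>2"
      by (rule \<delta>0(2)) (use that deriv_in_clarke_jacobian in \<open>auto simp: \<delta>_def\<close>)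
    also have "\<dots> \<le> M * \<bar>c - z\<bar>\<^sup>2" by (simp add: M_def mult_right_mono)
    finally show ?thesis using \<open>f z = 0\<close> by simp
  qed
  have quot: "\<bar>f y / (y - z) - v\<bar> \<le> M * \<bar>y - z\<bar>" if y: "0 < \<bar>y - z\<bar>" "\<bar>y - z\<bar> < \<delta>" for y
  proof (rule field_le_epsilon)
    fix e :: real assume "e > 0"
    obtain d where d: "d > 0" "\<And>x y. \<bar>x - z\<bar> < d \<Longrightarrow> \<bar>y - z\<bar> < d \<Longrightarrow>
        \<bar>f x - f y - v * (x - y)\<bar> \<le> e * \<bar>x - y\<bar>"
      using clarke_singleton_strict_derivative[OF lip clarke \<open>e > 0\<close>] by blast
    \<comment> \<open>a point between \<open>z\<close> and \<open>y\<close>, close enough to \<open>z\<close> for the strict derivative to act\<close>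
    define t where "t = min (1 / 2) (d / (2 * \<bar>y - z\<bar>))"
    have t: "0 < t" "t \<le> 1 / 2" "t * \<bar>y - z\<bar> < d"
    proof -
      show "t \<le> 1 / 2" unfolding t_def by (rule min.cobounded1)
      have "t * \<bar>y - z\<bar> \<le> d / (2 * \<bar>y - z\<bar>) * \<bar>y - z\<bar>" by (intro mult_right_mono) (auto simp: t_def)
      also have "\<dots> < d" using y d by simp
      finally show "t * \<bar>y - z\<bar> < d" .
    qed (use y d in \<open>auto simp: t_def\<close>)
    define x where "x = z + t * (y - z)"
    have xz: "x - z = t * (y - z)" "\<bar>x - z\<bar> = t * \<bar>y - z\<bar>" using t by (auto simp: x_def abs_mult)
    have "x \<noteq> z" using t y by (auto simp: x_def)
    have "t * \<bar>y - z\<bar> < \<delta>"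
    proof -
      have "t * \<bar>y - z\<bar> \<le> 1 * \<bar>y - z\<bar>" using t by (intro mult_right_mono) auto
      also have "\<dots> < \<delta>" using y by simp
      finally show ?thesis .
    qed
    moreover have "(x > z \<and> y > z) \<or> (x < z \<and> y < z)"
      using t y by (auto simp: x_def mult_less_0_iff)
    ultimately have "\<bar>f x / (x - z) - f y / (y - z)\<bar> \<le> M * \<bar>x - y\<bar>"
      using xz y by (intro quotient_lipschitz_if_strongly_semismooth[OF lip\<delta> \<open>f z = 0\<close> deriv]) auto
    also have "\<dots> \<le> M * \<bar>y - z\<bar>"
    proof (intro mult_left_mono \<open>M \<ge> 0\<close>)
      have "\<bar>x - y\<bar> = (1 - t) * \<bar>y - z\<bar>"
      proof -
        have "x - y = (t - 1) * (y - z)" by (simp add: x_def algebra_simps)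
        then show ?thesis using t by (simp add: abs_mult)
      qed
      also have "\<dots> \<le> 1 * \<bar>y - z\<bar>" using t by (intro mult_right_mono) auto
      finally show "\<bar>x - y\<bar> \<le> \<bar>y - z\<bar>" by simp
    qed
    finally have "\<bar>f x / (x - z) - f y / (y - z)\<bar> \<le> M * \<bar>y - z\<bar>" .
    moreover have "\<bar>f x / (x - z) - v\<bar> \<le> e"
    proof -
      have "\<bar>f x - v * (x - z)\<bar> \<le> e * \<bar>x - z\<bar>" using d(2)[of x z] d(1) t xz \<open>f z = 0\<close> by simp
      moreover have "f x / (x - z) - v = (f x - v * (x - z)) / (x - z)"
        using \<open>x \<noteq> z\<close> by (simp add: field_simps)
      ultimately show ?thesis using \<open>x \<noteq> z\<close> by (simp add: abs_divide pos_divide_le_eq)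
    qed
    ultimately show "\<bar>f y / (y - z) - v\<bar> \<le> M * \<bar>y - z\<bar> + e" by linarith
  qed
  have deriv_rate: "\<bar>deriv f c - v\<bar> \<le> 2 * M * \<bar>c - z\<bar>" if c: "\<bar>c - z\<bar> < \<delta>" "f differentiable (at c)" for c
  proof (cases "c = z")
    case True
    then show ?thesis using deriv_in_clarke_jacobian[OF c(2)] clarke by simp
  next
    case False
    have "\<bar>f c / (c - z) - deriv f c\<bar> \<le> M * \<bar>c - z\<bar>"
    proof -
      have "f c / (c - z) - deriv f c = (f c - deriv f c * (c - z)) / (c - z)"
        using False by (simp add: field_simps)
      then have "\<bar>f c / (c - z) - deriv f c\<bar> \<le> M * \<bar>c - z\<bar>\<^sup>2 / \<bar>c - z\<bar>"
        using deriv[OF _ c] False by (simp add: abs_divide divide_right_mono)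
      also have "\<dots> = M * \<bar>c - z\<bar>"
        using False nonzero_mult_div_cancel_right[of "\<bar>c - z\<bar>" "M * \<bar>c - z\<bar>"]
        by (simp only: power2_eq_square mult.assoc abs_eq_0 right_minus_eq not_False_eq_True)
      finally show ?thesis .
    qed
    then show ?thesis using quot[of c] c False by auto
  qed
  show thesis
  proof (rule that[of "2 * M" \<delta>])
    fix x y assume xy: "\<bar>x - z\<bar> < \<delta>" "\<bar>y - z\<bar> < \<delta>"
    show "\<bar>f x - f y - v * (x - y)\<bar> \<le> 2 * M * max \<bar>x - z\<bar> \<bar>y - z\<bar> * \<bar>x - y\<bar>"
    proof (rule lipschitz_chord_approx)
      show "L-lipschitz_on {min x y..max x y} f"
        by (rule lipschitz_on_subset[OF lip\<delta>]) (use xy in auto)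
      fix c assume c: "min x y < c" "c < max x y" "f differentiable (at c)"
      then have cz: "\<bar>c - z\<bar> \<le> max \<bar>x - z\<bar> \<bar>y - z\<bar>" by auto
      then have "\<bar>deriv f c - v\<bar> \<le> 2 * M * \<bar>c - z\<bar>" using deriv_rate[OF _ c(3)] xy by auto
      also have "\<dots> \<le> 2 * M * max \<bar>x - z\<bar> \<bar>y - z\<bar>" using cz \<open>M \<ge> 0\<close> by (intro mult_left_mono) auto
      finally show "\<bar>deriv f c - v\<bar> \<le> 2 * M * max \<bar>x - z\<bar> \<bar>y - z\<bar>" .
    qed
  qed (use \<open>M \<ge> 0\<close> \<open>\<delta> > 0\<close> in auto)
qed

section \<open>Golden ratio order from error recurrences\<close>

text \<open>In logarithmic form the bound \<open>E (n + 2) \<le> C * E (n + 1) * E n\<close> is a Fibonacci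
  inequality, so \<open>- ln (E n)\<close> grows at least like the powers of the golden ratio.\<close>

lemma fibonacci_decay:
  fixes E :: "nat \<Rightarrow> real" and \<phi> :: real
  assumes \<phi>: "\<phi> > 1" "\<phi>\<^sup>2 = \<phi> + 1"
    and pos: "\<And>n. E n > 0" and lim: "E \<longlonglongrightarrow> 0" and "C > 0"
    and bound: "\<forall>\<^sub>F n in sequentially. E (n + 2) \<le> C * E (n + 1) * E n"
  obtains c where "c > 0" "\<forall>\<^sub>F n in sequentially. c * \<phi> ^ n \<le> - ln (E n)"
proof -
  \<comment> \<open>scaling by \<open>C\<close> absorbs the constant: \<open>u (n + 2) \<ge> u (n + 1) + u n\<close> eventually\<close>
  define u where "u n = - ln (C * E n)" for n
  have u: "u n = - ln (E n) - ln C" for n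
    using pos[of n] \<open>C > 0\<close> by (simp add: u_def ln_mult)
  have "\<forall>\<^sub>F n in sequentially. E n < exp (- 1) / C"
    by (rule order_tendstoD[OF lim]) (use \<open>C > 0\<close> in simp)
  then have "\<forall>\<^sub>F n in sequentially. u n \<ge> 1"
  proof (rule eventually_mono)
    fix n assume "E n < exp (- 1) / C"
    then have "C * E n \<le> exp (- 1)" using \<open>C > 0\<close> by (simp add: field_simps)
    then have "ln (C * E n) \<le> ln (exp (- 1))"
      using pos[of n] \<open>C > 0\<close> by (subst ln_le_cancel_iff) auto
    then show "u n \<ge> 1" by (simp add: u_def)
  qed
  moreover have "\<forall>\<^sub>F n in sequentially. u (n + 2) \<ge> u (n + 1) + u n"
    using bound
  proof (rule eventually_mono)
    fix n assume "E (n + 2) \<le> C * E (n + 1) * E n"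
    then have "ln (E (n + 2)) \<le> ln (C * E (n + 1) * E n)"
      using pos \<open>C > 0\<close> by (subst ln_le_cancel_iff) auto
    also have "\<dots> = ln C + ln (E (n + 1)) + ln (E n)"
      using pos[of n] pos[of "n + 1"] \<open>C > 0\<close> by (simp add: ln_mult)
    finally show "u (n + 2) \<ge> u (n + 1) + u n" by (simp add: u)
  qed
  ultimately obtain N where N: "\<And>n. n \<ge> N \<Longrightarrow> u n \<ge> 1" "\<And>n. n \<ge> N \<Longrightarrow> u (n + 2) \<ge> u (n + 1) + u n"
    by (metis (no_types, lifting) eventually_conj eventually_sequentially)
  have growth: "\<phi> ^ k \<le> \<phi> * u (N + k)" for k
  proof (induction k rule: induct_nat_012)
    case 0
    have "1 * 1 \<le> \<phi> * u N" using \<phi>(1) N(1)[of N] by (intro mult_mono) auto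
    then show ?case by simp
  next
    case 1
    have "\<phi> * 1 \<le> \<phi> * u (N + 1)" using \<phi>(1) N(1)[of "N + 1"] by (intro mult_left_mono) auto
    then show ?case by simp
  next
    case (ge2 k)
    have "\<phi> ^ Suc (Suc k) = \<phi> ^ k * \<phi>\<^sup>2" by (simp add: power2_eq_square)
    also have "\<dots> = \<phi> ^ Suc k + \<phi> ^ k" by (simp add: \<phi>(2) algebra_simps)
    also have "\<dots> \<le> \<phi> * u (N + Suc k) + \<phi> * u (N + k)" using ge2 by (rule add_mono[rotated])
    also have "\<dots> = \<phi> * (u (N + Suc k) + u (N + k))" by (rule distrib_left[symmetric])
    also have "\<dots> \<le> \<phi> * u (N + Suc (Suc k))"
      using N(2)[of "N + k"] \<phi>(1) by (intro mult_left_mono) auto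
    finally show ?case .
  qed
  define c where "c = 1 / \<phi> ^ (N + 1)"
  have "c > 0" using \<phi>(1) by (simp add: c_def)
  have u_ge: "c * \<phi> ^ n \<le> u n" if "n \<ge> N" for n
  proof -
    have "\<phi> ^ N * \<phi> ^ (n - N) \<le> \<phi> ^ N * (\<phi> * u n)"
      using growth[of "n - N"] that \<phi>(1) by (intro mult_left_mono) auto
    moreover have "\<phi> ^ N * \<phi> ^ (n - N) = \<phi> ^ n"
      using that by (simp only: power_add[symmetric] le_add_diff_inverse)
    ultimately have "\<phi> ^ n \<le> u n * \<phi> ^ (N + 1)" by (simp only: power_add power_one_right mult.assoc mult.commute mult.left_commute)
    then show ?thesis using \<phi>(1) by (simp add: c_def pos_divide_le_eq)
  qed
  show thesis
  proof (rule that[of "c / 2"])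
    have "filterlim (\<lambda>n. c / 2 * \<phi> ^ n) at_top sequentially"
      using \<phi>(1) \<open>c > 0\<close> by real_asymp
    then have "\<forall>\<^sub>F n in sequentially. - ln C \<le> c / 2 * \<phi> ^ n"
      by (simp only: filterlim_at_top)
    then show "\<forall>\<^sub>F n in sequentially. c / 2 * \<phi> ^ n \<le> - ln (E n)"
      using eventually_ge_at_top[of N]
    proof eventually_elim
      case (elim n)
      then have "c * \<phi> ^ n \<le> - ln (E n) - ln C" using u_ge u by metis
      moreover have "c * \<phi> ^ n = c / 2 * \<phi> ^ n + c / 2 * \<phi> ^ n" by (simp only: distrib_right[symmetric] field_sum_of_halves)
      ultimately show ?case using elim(1) by linarith
    qed
  qed (use \<open>c > 0\<close> in simp)
qed

lemma r_order_if_exponential_decay: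
  fixes e :: "nat \<Rightarrow> real"
  assumes nz: "\<And>n. e n \<noteq> 0" and "c > 0"
    and decay: "\<forall>\<^sub>F n in sequentially. c * \<phi> ^ n \<le> - ln \<bar>e n\<bar>"
  shows "r_order_at_least e \<phi>"
  unfolding r_order_at_least_def
proof (intro allI impI)
  fix q :: real assume q: "1 < q \<and> q < \<phi>"
  then have "\<phi> / q > 1" by simp
  moreover have "(\<lambda>n. exp (- (c * \<rho> ^ n))) \<longlonglongrightarrow> 0" if "\<rho> > 1" for \<rho> :: real
    using that \<open>c > 0\<close> by real_asymp
  ultimately have "(\<lambda>n. exp (- (c * (\<phi> / q) ^ n))) \<longlonglongrightarrow> 0" by blast
  then show "(\<lambda>k. \<bar>e k\<bar> powr (1 / q ^ k)) \<longlonglongrightarrow> 0"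
  proof (rule tendsto_sandwich[OF _ _ tendsto_const, rotated 2])
    show "\<forall>\<^sub>F n in sequentially. \<bar>e n\<bar> powr (1 / q ^ n) \<le> exp (- (c * (\<phi> / q) ^ n))"
      using decay
    proof (rule eventually_mono)
      fix n assume "c * \<phi> ^ n \<le> - ln \<bar>e n\<bar>"
      then have "c * \<phi> ^ n / q ^ n \<le> - ln \<bar>e n\<bar> / q ^ n" using q by (intro divide_right_mono) auto
      then have "1 / q ^ n * ln \<bar>e n\<bar> \<le> - (c * (\<phi> / q) ^ n)"
        by (simp add: power_divide)
      then show "\<bar>e n\<bar> powr (1 / q ^ n) \<le> exp (- (c * (\<phi> / q) ^ n))"
        using nz[of n] by (simp add: powr_def)
    qed
  qed auto
qed

text \<open>A lower bound on the error ratios turns the Fibonacci inequality into a perturbed linear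
  recurrence. Its component \<open>w n = l (n + 1) - \<phi> * l n\<close>, with \<open>l n = - ln \<bar>e n\<bar>\<close>, satisfies
  \<open>w (n + 1) = d n - w n / \<phi>\<close> with \<open>d n = O(n\<^sup>2)\<close>, so it grows at most polynomially, whereas
  \<open>l n\<close> grows exponentially.\<close>

lemma q_order_golden_if_decay:
  fixes e :: "nat \<Rightarrow> real" and \<phi> :: real
  assumes \<phi>: "\<phi> > 1" "\<phi>\<^sup>2 = \<phi> + 1"
    and nz: "\<And>n. e n \<noteq> 0" and "c > 0" and "B > 0" "C > 0"
    and decay: "\<forall>\<^sub>F n in sequentially. c * \<phi> ^ n \<le> - ln \<bar>e n\<bar>"
    and upper: "\<forall>\<^sub>F n in sequentially. \<bar>e (n + 2)\<bar> \<le> C * \<bar>e (n + 1)\<bar> * \<bar>e n\<bar>"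
    and lower: "\<forall>\<^sub>F n in sequentially.
      B * real (n + 2) powr (- real (n + 2)) \<le> \<bar>e (n + 2)\<bar> / (\<bar>e (n + 1)\<bar> * \<bar>e n\<bar>)"
  shows "q_order_at_least e \<phi>"
  unfolding q_order_at_least_def
proof (intro allI impI)
  fix q :: real assume q: "1 \<le> q \<and> q < \<phi>"
  define l where "l n = - ln \<bar>e n\<bar>" for n
  define w where "w n = l (n + 1) - \<phi> * l n" for n
  define d where "d n = l (n + 2) - l (n + 1) - l n" for n
  define A where "A = \<bar>ln C\<bar> + \<bar>ln B\<bar> + 1"
  have "A > 0" by (simp add: A_def)
  have rec: "w (n + 1) = d n - w n / \<phi>" for n
  proof -
    have "\<phi> - 1 = 1 / \<phi>" using \<phi> by (simp add: field_simps power2_eq_square)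
    have "w n / \<phi> = l (n + 1) * (1 / \<phi>) - l n"
      using \<phi>(1) by (simp add: w_def diff_divide_distrib)
    also have "\<dots> = l (n + 1) * (\<phi> - 1) - l n" using \<open>\<phi> - 1 = 1 / \<phi>\<close> by (simp only:)
    finally have "d n - w n / \<phi> = l (n + 2) - \<phi> * l (n + 1)"
      unfolding d_def by (simp only: right_diff_distrib mult_1_right) (simp add: mult.commute)
    then show ?thesis by (simp add: w_def)
  qed
  have "\<forall>\<^sub>F n in sequentially. \<bar>d n\<bar> \<le> A * real (n + 2) ^ 2"
    using upper lower
  proof eventually_elim
    case (elim n)
    define R where "R = \<bar>e (n + 2)\<bar> / (\<bar>e (n + 1)\<bar> * \<bar>e n\<bar>)"
    have "R > 0" using nz by (simp add: R_def)
    have d: "d n = - ln R"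
      using nz by (simp add: R_def d_def l_def ln_div ln_mult)
    have sq: "1 \<le> real (n + 2) ^ 2" by (rule one_le_power) simp
    have "R \<le> C" using elim(1) nz by (simp add: R_def pos_divide_le_eq mult.assoc)
    then have "ln R \<le> ln C" using \<open>R > 0\<close> \<open>C > 0\<close> by simp
    also have "\<dots> \<le> A * 1" by (simp add: A_def)
    also have "\<dots> \<le> A * real (n + 2) ^ 2" using sq \<open>A > 0\<close> by (intro mult_left_mono) auto
    finally have 1: "ln R \<le> A * real (n + 2) ^ 2" .
    have "ln (B * real (n + 2) powr (- real (n + 2))) \<le> ln R"
      using elim(2) \<open>B > 0\<close> by (subst ln_le_cancel_iff) (auto simp: R_def nz)
    moreover have "ln (B * real (n + 2) powr (- real (n + 2))) = ln B - real (n + 2) * ln (real (n + 2))"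
      using \<open>B > 0\<close> by (subst ln_mult) (auto simp: ln_powr algebra_simps)
    ultimately have "- ln R \<le> - ln B + real (n + 2) * ln (real (n + 2))" by linarith
    also have "real (n + 2) * ln (real (n + 2)) \<le> real (n + 2) * real (n + 2)"
      using ln_bound[of "real (n + 2)"] by (intro mult_left_mono) auto
    also have "- ln B \<le> \<bar>ln B\<bar> * real (n + 2) ^ 2"
      using mult_left_mono[OF sq, of "\<bar>ln B\<bar>"] by simp
    also have "\<bar>ln B\<bar> * real (n + 2) ^ 2 + real (n + 2) * real (n + 2) \<le> A * real (n + 2) ^ 2"
      by (simp add: A_def distrib_right power2_eq_square)
    finally have 2: "- ln R \<le> A * real (n + 2) ^ 2" by simp
    from 1 2 show ?case by (simp add: d abs_le_iff)
  qed
  then obtain N where N: "\<And>n. n \<ge> N \<Longrightarrow> \<bar>d n\<bar> \<le> A * real (n + 2) ^ 2"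
    unfolding eventually_sequentially by blast
  have w_le: "\<bar>w n\<bar> \<le> \<bar>w N\<bar> + A * real (n + 1) ^ 3" if "n \<ge> N" for n
    using that
  proof (induction n rule: dec_induct)
    case base
    then show ?case using \<open>A > 0\<close> by simp
  next
    case (step n)
    have "\<bar>w n / \<phi>\<bar> \<le> \<bar>w n\<bar>"
    proof -
      have "\<bar>w n / \<phi>\<bar> = \<bar>w n\<bar> / \<phi>" using \<phi>(1) by (simp add: abs_divide)
      also have "\<dots> \<le> \<bar>w n\<bar> / 1" using \<phi>(1) by (intro divide_left_mono) auto
      finally show ?thesis by simp
    qed
    then have "\<bar>w (Suc n)\<bar> \<le> \<bar>w n\<bar> + A * real (n + 2) ^ 2"
      using rec[of n] N[of n] step.hyps abs_triangle_ineq4[of "d n" "w n / \<phi>"] by simp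
    also have "\<dots> \<le> \<bar>w N\<bar> + (A * real (n + 1) ^ 3 + A * real (n + 2) ^ 2)" using step.IH by simp
    also have "A * real (n + 1) ^ 3 + A * real (n + 2) ^ 2 \<le> A * real (Suc n + 1) ^ 3"
    proof -
      have "real (n + 1) ^ 3 + real (n + 2) ^ 2 \<le> real (Suc n + 1) ^ 3"
        by (simp add: power3_eq_cube power2_eq_square algebra_simps)
      then show ?thesis using \<open>A > 0\<close> by (simp only: distrib_left[symmetric]) simp
    qed
    finally show ?case by simp
  qed
  define g where "g = (\<phi> - q) * c"
  have "g > 0" using q \<open>c > 0\<close> by (simp add: g_def)
  have "(\<lambda>n. exp (- (g * \<phi> ^ n - (\<bar>w N\<bar> + A * real (n + 1) ^ 3)))) \<longlonglongrightarrow> 0"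
    using \<phi>(1) \<open>g > 0\<close> by real_asymp
  then show "(\<lambda>k. \<bar>e (Suc k)\<bar> / \<bar>e k\<bar> powr q) \<longlonglongrightarrow> 0"
  proof (rule tendsto_sandwich[OF _ _ tendsto_const, rotated 2])
    show "\<forall>\<^sub>F n in sequentially. \<bar>e (Suc n)\<bar> / \<bar>e n\<bar> powr q
      \<le> exp (- (g * \<phi> ^ n - (\<bar>w N\<bar> + A * real (n + 1) ^ 3)))"
      using decay eventually_ge_at_top[of N]
    proof eventually_elim
      case (elim n)
      have "\<bar>e (Suc n)\<bar> / \<bar>e n\<bar> powr q = exp (- l (n + 1)) / exp (- (q * l n))"
        using nz[of n] nz[of "Suc n"] by (simp add: l_def powr_def)
      also have "\<dots> = exp (- (w n + (\<phi> - q) * l n))"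
        by (simp only: exp_diff[symmetric] w_def) (simp add: algebra_simps)
      finally have eq: "\<bar>e (Suc n)\<bar> / \<bar>e n\<bar> powr q = exp (- (w n + (\<phi> - q) * l n))" .
      have "(\<phi> - q) * (c * \<phi> ^ n) \<le> (\<phi> - q) * l n"
        using elim(1) q unfolding l_def by (intro mult_left_mono) auto
      then have "g * \<phi> ^ n \<le> (\<phi> - q) * l n" by (simp only: g_def mult.assoc)
      moreover have "- w n \<le> \<bar>w N\<bar> + A * real (n + 1) ^ 3" using w_le[OF elim(2)] by linarith
      ultimately show ?case unfolding eq exp_le_cancel_iff by linarith
    qed
  qed auto
qed

section \<open>Errors of the secant method\<close>

lemma q_superlinearI:
  assumes "e \<longlonglongrightarrow> 0" "\<And>c. c > 0 \<Longrightarrow> \<forall>\<^sub>F n in sequentially. \<bar>e (Suc n)\<bar> \<le> c * \<bar>e n\<bar>"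
  shows "q_superlinear e"
  unfolding q_superlinear_def using assms by (auto intro!: landau_o.smallI)



text \<open>With \<open>D\<close> the divided difference, the new error is
  \<open>((D - v) * (x - z) - (f x - v * (x - z))) / D\<close>: the current error times the discrepancy of two
  chord slopes, which both approximate \<open>v\<close>, divided by \<open>D\<close>.\<close>

lemma secant_step_error_le:
  fixes f :: "real \<Rightarrow> real"
  assumes chord: "\<bar>f x - f y - v * (x - y)\<bar> \<le> \<eta> * \<bar>x - y\<bar>"
    and chord_root: "\<bar>f x - v * (x - z)\<bar> \<le> \<eta>' * \<bar>x - z\<bar>"
    and "x \<noteq> y" "v \<noteq> 0" "\<eta> \<le> \<bar>v\<bar> / 2"
  shows "\<bar>x - inverse (divided_difference f x y) * f x - z\<bar> \<le> 2 * (\<eta> + \<eta>') / \<bar>v\<bar> * \<bar>x - z\<bar>"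
proof -
  define D where "D = divided_difference f x y"
  have "D - v = (f x - f y - v * (x - y)) / (x - y)"
    using \<open>x \<noteq> y\<close> by (simp add: D_def divided_difference_def field_simps)
  then have Dv: "\<bar>D - v\<bar> \<le> \<eta>" using chord \<open>x \<noteq> y\<close> by (simp add: abs_divide pos_divide_le_eq)
  then have D: "\<bar>v\<bar> / 2 \<le> \<bar>D\<bar>" using assms(5) by linarith
  then have "D \<noteq> 0" using \<open>v \<noteq> 0\<close> by auto
  have "x - inverse D * f x - z = ((D - v) * (x - z) - (f x - v * (x - z))) / D"
    using \<open>D \<noteq> 0\<close> by (simp add: field_simps)
  then have "\<bar>x - inverse D * f x - z\<bar> = \<bar>(D - v) * (x - z) - (f x - v * (x - z))\<bar> / \<bar>D\<bar>"
    by (simp only: abs_divide)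
  also have "\<dots> \<le> (\<eta> + \<eta>') * \<bar>x - z\<bar> / (\<bar>v\<bar> / 2)"
  proof (rule frac_le)
    have "\<bar>(D - v) * (x - z) - (f x - v * (x - z))\<bar> \<le> \<bar>D - v\<bar> * \<bar>x - z\<bar> + \<bar>f x - v * (x - z)\<bar>"
      by (metis abs_mult abs_triangle_ineq4)
    also have "\<dots> \<le> \<eta> * \<bar>x - z\<bar> + \<eta>' * \<bar>x - z\<bar>"
      using Dv chord_root by (intro add_mono mult_right_mono) auto
    finally show num: "\<bar>(D - v) * (x - z) - (f x - v * (x - z))\<bar> \<le> (\<eta> + \<eta>') * \<bar>x - z\<bar>"
      by (simp only: distrib_right)
    then show "0 \<le> (\<eta> + \<eta>') * \<bar>x - z\<bar>" by linarith
  qed (use D \<open>v \<noteq> 0\<close> in auto)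
  also have "\<dots> = 2 * (\<eta> + \<eta>') / \<bar>v\<bar> * \<bar>x - z\<bar>" by (simp add: algebra_simps)
  finally show ?thesis unfolding D_def .
qed

lemma secant_sequence_neq:
  assumes "secant_sequence f x" "k \<ge> 0"
  shows "x k \<noteq> x (k - 1)"
proof (cases "k = 0")
  case True
  then show ?thesis using assms(1) by (simp add: secant_sequence_def)
next
  case False
  then have "k - 1 \<ge> 0" using assms(2) by simp
  then have "f (x (k - 1)) \<noteq> 0" "divided_difference f (x (k - 1)) (x (k - 1 - 1)) \<noteq> 0"
    "x (k - 1 + 1) = x (k - 1) - inverse (divided_difference f (x (k - 1)) (x (k - 1 - 1))) * f (x (k - 1))"
    using assms(1) unfolding secant_sequence_def by blast+
  then show ?thesis by simp
qed

lemma secant_sequence_error_le: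
  assumes sec: "secant_sequence f x" and "f z = 0" "v \<noteq> 0" "\<eta> \<le> \<bar>v\<bar> / 2"
    and "\<bar>f (x (int (Suc n))) - f (x (int n)) - v * (x (int (Suc n)) - x (int n))\<bar>
      \<le> \<eta> * \<bar>x (int (Suc n)) - x (int n)\<bar>"
    and "\<bar>f (x (int (Suc n))) - f z - v * (x (int (Suc n)) - z)\<bar> \<le> \<eta>' * \<bar>x (int (Suc n)) - z\<bar>"
  shows "\<bar>x (int (Suc (Suc n))) - z\<bar> \<le> 2 * (\<eta> + \<eta>') / \<bar>v\<bar> * \<bar>x (int (Suc n)) - z\<bar>"
proof -
  let ?k = "int (Suc n)"
  have k: "?k \<ge> 0" "?k - 1 = int n" "?k + 1 = int (Suc (Suc n))" by simp_all
  have "x (?k + 1) = x ?k - inverse (divided_difference f (x ?k) (x (?k - 1))) * f (x ?k)"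
    using sec k(1) unfolding secant_sequence_def by blast
  then have step: "x (int (Suc (Suc n))) =
      x ?k - inverse (divided_difference f (x ?k) (x (int n))) * f (x ?k)"
    by (simp only: k)
  have "x ?k \<noteq> x (int n)" using secant_sequence_neq[OF sec k(1)] unfolding k(2) .
  then show ?thesis
    unfolding step using assms(6) \<open>v \<noteq> 0\<close> assms(4,5) unfolding \<open>f z = 0\<close> diff_0_right
    by (intro secant_step_error_le)
qed

text \<open>Once two consecutive iterates are close to the root, the errors are halved at every step.\<close>

lemma secant_sequence_tendsto:
  assumes lip: "locally_lipschitz f" and root: "f z = 0"
    and clarke: "clarke_jacobian f z = {v}" and v: "v \<noteq> 0"
  obtains r where "r > 0"
    "\<And>x m. secant_sequence f x \<Longrightarrow> m \<ge> 0 \<Longrightarrow> \<bar>x (m - 1) - z\<bar> < r \<Longrightarrow> \<bar>x m - z\<bar> < r \<Longrightarrow>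
      (\<lambda>n. x (int n) - z) \<longlonglongrightarrow> 0"
proof -
  \<comment> \<open>slopes within \<open>\<bar>v\<bar> / 8\<close> of \<open>v\<close> make the step factor \<open>2 * (1/8 + 1/8) = 1/2\<close>\<close>
  have "\<bar>v\<bar> / 8 > 0" using v by simp
  then obtain r where r: "r > 0" "\<And>x y. \<bar>x - z\<bar> < r \<Longrightarrow> \<bar>y - z\<bar> < r \<Longrightarrow>
      \<bar>f x - f y - v * (x - y)\<bar> \<le> \<bar>v\<bar> / 8 * \<bar>x - y\<bar>"
    using clarke_singleton_strict_derivative[OF lip clarke] by blast
  show thesis
  proof (rule that[OF r(1)])
    fix x :: "int \<Rightarrow> real" and m :: int
    assume sec: "secant_sequence f x" and m: "m \<ge> 0" "\<bar>x (m - 1) - z\<bar> < r" "\<bar>x m - z\<bar> < r"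
    have step: "\<bar>x (k + 1) - z\<bar> \<le> 1 / 2 * \<bar>x k - z\<bar>"
      if k: "k \<ge> 0" "\<bar>x (k - 1) - z\<bar> < r" "\<bar>x k - z\<bar> < r" for k
    proof -
      have "x (k + 1) = x k - inverse (divided_difference f (x k) (x (k - 1))) * f (x k)"
        using sec k(1) unfolding secant_sequence_def by blast
      then have "\<bar>x (k + 1) - z\<bar> \<le> 2 * (\<bar>v\<bar> / 8 + \<bar>v\<bar> / 8) / \<bar>v\<bar> * \<bar>x k - z\<bar>"
        using r(2)[OF k(3,2)] r(2)[of "x k" z] r(1) k root v secant_sequence_neq[OF sec k(1)]
        by (simp only:) (intro secant_step_error_le, auto)
      also have "2 * (\<bar>v\<bar> / 8 + \<bar>v\<bar> / 8) / \<bar>v\<bar> = 1 / 2" using v by (simp add: field_simps)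
      finally show ?thesis .
    qed
    define N where "N = nat m"
    have near: "\<bar>x (m + int n - 1) - z\<bar> < r \<and> \<bar>x (m + int n) - z\<bar> < r \<and>
      \<bar>x (m + int n) - z\<bar> \<le> (1 / 2) ^ n * r" for n
    proof (induction n)
      case 0
      then show ?case using m by simp
    next
      case (Suc n)
      have le: "\<bar>x (m + int n + 1) - z\<bar> \<le> 1 / 2 * \<bar>x (m + int n) - z\<bar>"
        by (rule step) (use Suc m in auto)
      have idx: "m + int (Suc n) = m + int n + 1" "m + int n + 1 - 1 = m + int n" by simp_all
      have half: "a < r" if "a \<le> 1 / 2 * b" "b < r" "0 \<le> b" for a b :: real
        using that by linarith
      have "\<bar>x (m + int n + 1) - z\<bar> < r" by (rule half[OF le]) (use Suc in auto)
      then show ?case unfolding idx using le Suc by simp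
    qed
    have "(\<lambda>n. (1 / 2) ^ n * r) \<longlonglongrightarrow> 0"
      by (intro tendsto_mult_left_zero LIMSEQ_realpow_zero) auto
    then have "(\<lambda>n. x (m + int n) - z) \<longlonglongrightarrow> 0"
      by (rule Lim_null_comparison[rotated]) (use near in auto)
    then have "(\<lambda>n. x (int (n + N)) - z) \<longlonglongrightarrow> 0" using m(1) by (simp add: N_def add.commute)
    then show "(\<lambda>n. x (int n) - z) \<longlonglongrightarrow> 0" by (rule LIMSEQ_offset)
  qed
qed

lemma secant_sequence_q_superlinear:
  assumes lip: "locally_lipschitz f" and root: "f z = 0"
    and clarke: "clarke_jacobian f z = {v}" and v: "v \<noteq> 0"
    and sec: "secant_sequence f x" and lim: "(\<lambda>n. x (int n) - z) \<longlonglongrightarrow> 0"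
  shows "q_superlinear (\<lambda>n. x (int n) - z)"
proof (rule q_superlinearI[OF lim])
  fix c :: real assume "c > 0"
  \<comment> \<open>small enough to keep the divided difference away from 0 and to make the step factor
    \<open>4 * \<eta> / \<bar>v\<bar>\<close> at most \<open>c\<close>\<close>
  define \<eta> where "\<eta> = min (\<bar>v\<bar> / 2) (c * \<bar>v\<bar> / 4)"
  have \<eta>: "\<eta> > 0" "\<eta> \<le> \<bar>v\<bar> / 2" "4 * \<eta> \<le> c * \<bar>v\<bar>"
    using v \<open>c > 0\<close> by (auto simp: \<eta>_def)
  obtain d where d: "d > 0" "\<And>x y. \<bar>x - z\<bar> < d \<Longrightarrow> \<bar>y - z\<bar> < d \<Longrightarrow>
      \<bar>f x - f y - v * (x - y)\<bar> \<le> \<eta> * \<bar>x - y\<bar>"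
    using clarke_singleton_strict_derivative[OF lip clarke \<eta>(1)] by blast
  have "\<forall>\<^sub>F n in sequentially. \<bar>x (int n) - z\<bar> < d"
    using tendstoD[OF lim d(1)] by (simp add: dist_real_def)
  then obtain N where N: "\<And>n. n \<ge> N \<Longrightarrow> \<bar>x (int n) - z\<bar> < d"
    unfolding eventually_sequentially by blast
  have "\<bar>x (int (Suc n)) - z\<bar> \<le> c * \<bar>x (int n) - z\<bar>" if "n \<ge> Suc N" for n
  proof -
    define k where "k = n - 1"
    have k: "n = Suc k" "k \<ge> N" using that by (auto simp: k_def)
    have "\<bar>x (int (Suc (Suc k))) - z\<bar> \<le> 2 * (\<eta> + \<eta>) / \<bar>v\<bar> * \<bar>x (int (Suc k)) - z\<bar>"
      by (rule secant_sequence_error_le[OF sec root v \<eta>(2)]; rule d(2))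
        (use N[of k] N[of "Suc k"] k d(1) in auto)
    also have "\<dots> \<le> c * \<bar>x (int (Suc k)) - z\<bar>"
      using \<eta>(3) v by (intro mult_right_mono) (auto simp: pos_divide_le_eq)
    finally show ?thesis using k by simp
  qed
  then show "\<forall>\<^sub>F n in sequentially. \<bar>x (int (Suc n)) - z\<bar> \<le> c * \<bar>x (int n) - z\<bar>"
    unfolding eventually_sequentially by blast
qed

text \<open>The error ratios stay bounded. Of superlinear convergence, only the convergence and the
  eventual monotonicity of the errors matter: the chord slope then deviates from \<open>v\<close> by at most a
  multiple of the older error.\<close>

lemma secant_sequence_product_bound:
  assumes lip: "locally_lipschitz f" and root: "f z = 0"
    and clarke: "clarke_jacobian f z = {v}" and v: "v \<noteq> 0"
    and strong: "strongly_semismooth_at f z"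
    and sec: "secant_sequence f x" and superlin: "q_superlinear (\<lambda>n. x (int n) - z)"
  obtains C where "C > 0"
    "\<forall>\<^sub>F n in sequentially. \<bar>x (int (n + 2)) - z\<bar> \<le> C * \<bar>x (int (n + 1)) - z\<bar> * \<bar>x (int n) - z\<bar>"
proof -
  obtain M d where M: "M \<ge> 0" "d > 0" "\<And>x y. \<bar>x - z\<bar> < d \<Longrightarrow> \<bar>y - z\<bar> < d \<Longrightarrow>
      \<bar>f x - f y - v * (x - y)\<bar> \<le> M * max \<bar>x - z\<bar> \<bar>y - z\<bar> * \<bar>x - y\<bar>"
    using strongly_semismooth_chord_rate[OF lip root clarke strong] by blast
  define r where "r = min d (\<bar>v\<bar> / (2 * (M + 1)))"
  have "r > 0" using M v by (simp add: r_def)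
  have lim: "(\<lambda>n. x (int n) - z) \<longlonglongrightarrow> 0" using superlin by (simp add: q_superlinear_def)
  have "\<forall>\<^sub>F n in sequentially. \<bar>x (int n) - z\<bar> < r"
    using tendstoD[OF lim \<open>r > 0\<close>] by (simp add: dist_real_def)
  moreover have "\<forall>\<^sub>F n in sequentially. \<bar>x (int (Suc n)) - z\<bar> \<le> \<bar>x (int n) - z\<bar>"
    using superlin landau_o.smallD[of "\<lambda>n. \<bar>x (int (Suc n)) - z\<bar>" _ _ 1]
    unfolding q_superlinear_def by fastforce
  ultimately have *: "\<forall>\<^sub>F n in sequentially. \<bar>x (int (n + 2)) - z\<bar>
      \<le> (4 * M / \<bar>v\<bar> + 1) * \<bar>x (int (n + 1)) - z\<bar> * \<bar>x (int n) - z\<bar>"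
  proof eventually_elim
    case (elim n)
    define a b where "a = \<bar>x (int n) - z\<bar>" and "b = \<bar>x (int (Suc n)) - z\<bar>"
    have ab: "0 \<le> b" "b \<le> a" "a < r" using elim by (auto simp: a_def b_def)
    have "M * a \<le> (M + 1) * (\<bar>v\<bar> / (2 * (M + 1)))"
      using ab M(1) by (intro mult_mono) (auto simp: r_def)
    also have "\<dots> = \<bar>v\<bar> / 2"
    proof -
      have cancel: "K * (\<bar>v\<bar> / (2 * K)) = \<bar>v\<bar> / 2" if "K > 0" for K using that by simp
      show ?thesis by (rule cancel) (use M(1) in simp)
    qed
    finally have small: "M * a \<le> \<bar>v\<bar> / 2" .
    have "\<bar>x (int (Suc (Suc n))) - z\<bar> \<le> 2 * (M * a + M * b) / \<bar>v\<bar> * b"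
      unfolding b_def
    proof (rule secant_sequence_error_le[OF sec root v small])
      show "\<bar>f (x (int (Suc n))) - f (x (int n)) - v * (x (int (Suc n)) - x (int n))\<bar>
          \<le> M * a * \<bar>x (int (Suc n)) - x (int n)\<bar>"
        using M(3)[of "x (int (Suc n))" "x (int n)"] ab by (simp add: a_def b_def r_def max_absorb2)
      show "\<bar>f (x (int (Suc n))) - f z - v * (x (int (Suc n)) - z)\<bar>
          \<le> M * \<bar>x (int (Suc n)) - z\<bar> * \<bar>x (int (Suc n)) - z\<bar>"
        using M(3)[of "x (int (Suc n))" z] ab M(2) by (simp add: a_def b_def r_def max_absorb1)
    qed
    also have "\<dots> \<le> (4 * M / \<bar>v\<bar> * a) * b"
    proof (intro mult_right_mono)
      have "M * b \<le> M * a" using ab M(1) by (intro mult_left_mono)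
      then have "2 * (M * a + M * b) / \<bar>v\<bar> \<le> 4 * (M * a) / \<bar>v\<bar>"
        by (intro divide_right_mono) auto
      then show "2 * (M * a + M * b) / \<bar>v\<bar> \<le> 4 * M / \<bar>v\<bar> * a" by simp
    qed (use ab in auto)
    also have "\<dots> \<le> ((4 * M / \<bar>v\<bar> + 1) * a) * b"
      using ab by (intro mult_right_mono) auto
    finally show ?case by (simp add: a_def b_def mult_ac)
  qed
  moreover have "4 * M / \<bar>v\<bar> + 1 > 0"
    using M(1) by (simp add: add_nonneg_pos)
  ultimately show thesis using that by blast
qed

section \<open>Convergence orders of the secant method\<close>

lemma eventually_ge_if_no_subsequence:
  fixes a b :: "nat \<Rightarrow> real"
  assumes "\<nexists>i :: nat \<Rightarrow> nat. strict_mono i \<and> (\<forall>k. i k \<ge> 1 \<and> a (i k) < b (i k))"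
  shows "\<forall>\<^sub>F n in sequentially. b n \<le> a n"
proof -
  define S where "S = {n. n \<ge> 1 \<and> a n < b n}"
  have "finite S"
  proof (rule ccontr)
    assume "infinite S"
    then have "strict_mono (enumerate S)" "\<And>k. enumerate S k \<in> S"
      by (auto intro: strict_mono_enumerate enumerate_in_set)
    then show False using assms by (auto simp: S_def)
  qed
  then obtain N where N: "\<And>n. n \<in> S \<Longrightarrow> n \<le> N" by (meson finite_nat_set_iff_bounded_le)
  have "b n \<le> a n" if "n \<ge> Suc N" for n
    using N[of n] that by (cases "a n < b n") (auto simp: S_def)
  then show ?thesis unfolding eventually_sequentially by blast
qed

theorem proposition5p2:
  fixes f :: "real \<Rightarrow> real" and xs :: real
  assumes lip: "locally_lipschitz f"
    and root: "f xs = 0"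
    and nondeg: "\<exists>v. clarke_jacobian f xs = {v} \<and> v \<noteq> 0"
  shows "\<exists>r>0. \<forall>(x :: int \<Rightarrow> real) (e :: int \<Rightarrow> real).
    secant_sequence f x \<and>
    (\<forall>k. e k = x k - xs) \<and>
    (\<forall>k\<ge>-1. \<bar>e k\<bar> > 0) \<and>
    (\<exists>m\<ge>0. \<bar>e (m - 1)\<bar> < r \<and> \<bar>e m\<bar> < r) \<longrightarrow>
    (semismooth_at f xs \<longrightarrow> q_superlinear (\<lambda>k. e (int k))) \<and>
    (strongly_semismooth_at f xs \<longrightarrow>
       (q_superlinear (\<lambda>k. e (int k)) \<and>
        q_order_at_least (\<lambda>k. e (int k)) ((1 + sqrt 5) / 2)) \<or>
       (q_superlinear (\<lambda>k. e (int k)) \<and>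
        r_order_at_least (\<lambda>k. e (int k)) ((1 + sqrt 5) / 2) \<and>
        (\<forall>C>0. \<exists>i :: nat \<Rightarrow> nat. strict_mono i \<and>
           (\<forall>k. i k \<ge> 1 \<and>
              error_ratio e (int (i k)) < C * real (i k) powr (- real (i k))))))"
proof -
  obtain v where clarke: "clarke_jacobian f xs = {v}" and v: "v \<noteq> 0" using nondeg by blast
  obtain r where "r > 0" and conv: "\<And>x m. secant_sequence f x \<Longrightarrow> m \<ge> 0 \<Longrightarrow>
      \<bar>x (m - 1) - xs\<bar> < r \<Longrightarrow> \<bar>x m - xs\<bar> < r \<Longrightarrow> (\<lambda>n. x (int n) - xs) \<longlonglongrightarrow> 0"
    using secant_sequence_tendsto[OF lip root clarke v] by blast
  define \<phi> :: real where "\<phi> = (1 + sqrt 5) / 2"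
  have "sqrt 5 > sqrt 1" by (subst real_sqrt_less_iff) simp
  then have \<phi>: "\<phi> > 1" "\<phi>\<^sup>2 = \<phi> + 1" by (simp_all add: \<phi>_def power2_eq_square field_simps)
  show ?thesis unfolding \<phi>_def[symmetric]
  proof (intro exI[of _ r] conjI allI impI \<open>r > 0\<close>; elim conjE exE)
    fix x e :: "int \<Rightarrow> real" and m :: int
    assume sec: "secant_sequence f x" and e: "\<forall>k. e k = x k - xs" and nz: "\<forall>k\<ge>-1. \<bar>e k\<bar> > 0"
      and m: "0 \<le> m" "\<bar>e (m - 1)\<bar> < r" "\<bar>e m\<bar> < r"
    have e_eq: "(\<lambda>n. e (int n)) = (\<lambda>n. x (int n) - xs)" using e by simp
    have "(\<lambda>n. x (int n) - xs) \<longlonglongrightarrow> 0" by (rule conv[OF sec m(1)]) (use m e in auto)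
    then have superlin_x: "q_superlinear (\<lambda>n. x (int n) - xs)"
      by (rule secant_sequence_q_superlinear[OF lip root clarke v sec])
    then show superlin: "q_superlinear (\<lambda>k. e (int k))" by (simp only: e_eq)
    assume strong: "strongly_semismooth_at f xs"
    define E where "E n = e (int n)" for n :: nat
    have E_nz: "E n \<noteq> 0" for n using nz[rule_format, of "int n"] by (auto simp: E_def)
    obtain C where "C > 0" and upper:
      "\<forall>\<^sub>F n in sequentially. \<bar>E (n + 2)\<bar> \<le> C * \<bar>E (n + 1)\<bar> * \<bar>E n\<bar>"
      using secant_sequence_product_bound[OF lip root clarke v strong sec superlin_x]
      unfolding E_def e[rule_format] by blast
    have "(\<lambda>n. \<bar>E n\<bar>) \<longlonglongrightarrow> 0"
      using superlin unfolding q_superlinear_def E_def by (simp add: tendsto_rabs_zero)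
    then obtain c where "c > 0" and decay: "\<forall>\<^sub>F n in sequentially. c * \<phi> ^ n \<le> - ln \<bar>E n\<bar>"
      using fibonacci_decay[OF \<phi> _ _ \<open>C > 0\<close> upper] E_nz by auto
    show "(q_superlinear (\<lambda>k. e (int k)) \<and> q_order_at_least (\<lambda>k. e (int k)) \<phi>) \<or>
      (q_superlinear (\<lambda>k. e (int k)) \<and> r_order_at_least (\<lambda>k. e (int k)) \<phi> \<and>
        (\<forall>C>0. \<exists>i :: nat \<Rightarrow> nat. strict_mono i \<and>
           (\<forall>k. i k \<ge> 1 \<and> error_ratio e (int (i k)) < C * real (i k) powr (- real (i k)))))"
    proof (cases "\<forall>C>0. \<exists>i :: nat \<Rightarrow> nat. strict_mono i \<and>
           (\<forall>k. i k \<ge> 1 \<and> error_ratio e (int (i k)) < C * real (i k) powr (- real (i k)))")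
      case True
      have "r_order_at_least E \<phi>" by (rule r_order_if_exponential_decay[OF E_nz \<open>c > 0\<close> decay])
      then show ?thesis using superlin True unfolding E_def by blast
    next
      case False
      \<comment> \<open>the error ratios are eventually at least \<open>B * n powr (- n)\<close>\<close>
      then obtain B where "B > 0" and no_sub: "\<nexists>i :: nat \<Rightarrow> nat. strict_mono i \<and>
           (\<forall>k. i k \<ge> 1 \<and> error_ratio e (int (i k)) < B * real (i k) powr (- real (i k)))"
        by blast
      have "\<forall>\<^sub>F n in sequentially. B * real n powr (- real n) \<le> error_ratio e (int n)"
        by (rule eventually_ge_if_no_subsequence[OF no_sub])
      then have "\<forall>\<^sub>F n in sequentially.
          B * real (n + 2) powr (- real (n + 2)) \<le> error_ratio e (int (n + 2))"
        by (rule eventually_compose_filterlim) (rule filterlim_add_const_nat_at_top)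
      then have "\<forall>\<^sub>F n in sequentially.
          B * real (n + 2) powr (- real (n + 2)) \<le> \<bar>E (n + 2)\<bar> / (\<bar>E (n + 1)\<bar> * \<bar>E n\<bar>)"
        by (simp add: error_ratio_def E_def add.commute)
      then have "q_order_at_least E \<phi>"
        by (rule q_order_golden_if_decay[OF \<phi> E_nz \<open>c > 0\<close> \<open>B > 0\<close> \<open>C > 0\<close> decay upper])
      then show ?thesis using superlin unfolding E_def by blast
    qed
  qed
qed

end
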